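(* For all $n\in\mathbb Z$, $\overset{\rightarrow}{L}_n\phi_+$ equals $$\phi_+'(z)\left(\left[\frac{\phi_+(z)^{n+1}}{\phi_+'(z)}+\left(z^{-2}\frac{\phi_+(z)^{n+1}}{\phi_+'(z)}\right)^*\right]_{++}-\frac12z\left(\mathrm{Res}\left(\frac{\phi_+(s)^{n+1}}{\phi_+'(s)s^2},s=0\right)+\mathrm{Res}\left(\frac{\phi_+(s)^{n+1}}{\phi_+'(s)s^2},s=0\right)^*\right)\right)$$ $$=\phi_+'(z)\left(\frac12(c_1+\overline{c_1})z+\sum_{k>1}(c_k+\overline{c_{2-k}})z^k\right),$$ where $$\frac{\phi_+(z)^{n+1}}{\phi_+'(z)}=\sum_{k=n+1}^{\infty}c_kz^k$$ (with $c_k=0$ for $k<n+1$).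
   Context: $\mathrm{Loop}^1(\mathbb C\setminus\{0\})$ is the set of compact subsets $\gamma\subset\mathbb C\setminus\{0\}$ homeomorphic to $S^1$ which surround $0$. For such $\gamma$ let $U_+\ni0$ be the bounded component of $\mathbb C\setminus\gamma$ and let $\phi_+:(\Delta,0)\to(U_+,0)$, $\Delta=\{|z|<1\}$, be the conformal isomorphism normalized by $\phi_+(0)=0$, $\phi_+'(0)>0$. For fixed $z$, $\phi_+(z)$ is a function of $\gamma$. $\overset{\rightarrow}{L}_n$ is the real vector field on $\mathbb C\setminus\{0\}$ corresponding to $v(z)=-z^{n+1}$ (i.e. $v_1\partial_x+v_2\partial_y$, $v=v_1+iv_2$). It acts on functions $F$ of $\gamma$ by $(\overset{\rightarrow}{L}_nF)(\gamma)=\frac{d}{dt}\big|_{t=0}F(\exp(-t\overset{\rightarrow}{L}_n)(\gamma))=\frac{d}{dt}\big|_{t=0}F(\gamma+t\gamma^{n+1})$, where $\exp(t\overset{\rightarrow}{L}_n)$ is the flow. The action on $\phi_+$ is pointwise in $z$. For a Laurent expansion $f(z)=\sum_kf_kz^k$ at $z=0$: $f^*(z)=\sum_k\overline{f_k}\,z^{-k}$ (formal Laurent series); $f_{++}(z)=\sum_{k>0}f_kz^k$; $\mathrm{Res}(f(s),s=0)=f_{-1}$. For a complex number $c$, $c^*$ is its complex conjugate. *)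

theory Defs
  imports "HOL-Complex_Analysis.Complex_Analysis"
begin

definition Loop1 :: "complex set set" where
  "Loop1 = {\<gamma>. compact \<gamma> \<and> \<gamma> \<subseteq> - {0} \<and> \<gamma> homeomorphic sphere (0::complex) 1 \<and> 0 \<in> inside \<gamma>}"

text \<open>
  For a Jordan curve \<open>\<gamma>\<close>, \<open>inside \<gamma>\<close> is the bounded component of its complement.
  Requiring \<open>\<phi> \<in> extensional (ball 0 1)\<close> fixes the values outside the unit disc,
  so that the normalized Riemann map is unique as a total function.
\<close>
definition phi_plus :: "complex set \<Rightarrow> complex \<Rightarrow> complex" where
  "phi_plus \<gamma> = (THE \<phi>. \<phi> \<in> extensional (ball 0 1) \<and>
     \<phi> holomorphic_on ball 0 1 \<and> bij_betw \<phi> (ball 0 1) (inside \<gamma>) \<and>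
     \<phi> 0 = 0 \<and> deriv \<phi> 0 \<in> \<real> \<and> 0 < Re (deriv \<phi> 0))"

definition L_field :: "int \<Rightarrow> complex \<Rightarrow> complex" where
  "L_field n z = - (z powi (n + 1))"

text \<open>
  The image of \<open>A\<close> under the time-\<open>t\<close> flow of the vector field \<open>v\<close> on \<open>S\<close>.  The time \<open>t\<close> may
  be negative, hence \<open>closed_segment 0 t\<close>.  A point of \<open>A\<close> whose integral curve does not exist
  in \<open>S\<close> up to time \<open>t\<close> contributes nothing; for compact \<open>A \<subseteq> S\<close>, open \<open>S\<close>, and \<open>v\<close> locally Lipschitz
  on \<open>S\<close>, there are no such points when \<open>t\<close> is small.
\<close>
definition flow_image :: "(complex \<Rightarrow> complex) \<Rightarrow> complex set \<Rightarrow> real \<Rightarrow> complex set \<Rightarrow> complex set" where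
  "flow_image v S t A = {y. \<exists>x\<in>A. \<exists>u :: real \<Rightarrow> complex. u 0 = x \<and> u t = y \<and>
     (\<forall>s\<in>closed_segment 0 t. u s \<in> S \<and>
        (u has_vector_derivative v (u s)) (at s within closed_segment 0 t))}"

definition exp_L :: "int \<Rightarrow> real \<Rightarrow> complex set \<Rightarrow> complex set" where
  "exp_L n t \<gamma> = flow_image (L_field n) (- {0}) t \<gamma>"

text \<open>The derivative defining the action of the vector field on \<open>F\<close> exists at \<open>\<gamma>\<close>, with value \<open>D\<close>.\<close>
definition has_L_action :: "int \<Rightarrow> (complex set \<Rightarrow> complex) \<Rightarrow> complex set \<Rightarrow> complex \<Rightarrow> bool" where
  "has_L_action n F \<gamma> D \<longleftrightarrow> ((\<lambda>t. F (exp_L n (- t) \<gamma>)) has_vector_derivative D) (at 0)"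

text \<open>
  A formal Laurent series, possibly infinite in both directions, is represented by its
  coefficient function \<open>int \<Rightarrow> complex\<close>; the type \<open>fls\<close> is not closed under \<open>laurent_star\<close>.
\<close>
definition laurent_coeff :: "(complex \<Rightarrow> complex) \<Rightarrow> int \<Rightarrow> complex" where
  "laurent_coeff f = fls_nth (laurent_expansion f 0)"

definition laurent_star :: "(int \<Rightarrow> complex) \<Rightarrow> int \<Rightarrow> complex" where
  "laurent_star a = (\<lambda>k. cnj (a (- k)))"

definition laurent_pos :: "(int \<Rightarrow> complex) \<Rightarrow> int \<Rightarrow> complex" where
  "laurent_pos a = (\<lambda>k. if k > 0 then a k else 0)"

definition Res0 :: "(complex \<Rightarrow> complex) \<Rightarrow> complex" where
  "Res0 f = fls_residue (laurent_expansion f 0)"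

end

theory Submission
  imports Defs
begin

text \<open>
  Pull the flow \<open>z' = z ^ (n + 1)\<close> back to the unit disc by the Riemann map \<open>\<phi>\<close> of the interior of \<open>\<gamma>\<close>.
  The resulting field \<open>f\<close> has only finitely many negative Laurent coefficients, so it splits as
  \<open>f = z h + z w\<close> with \<open>h\<close> holomorphic in the disc, \<open>h 0\<close> real, and \<open>z w\<close> a Laurent polynomial tangential
  to the unit circle.  To first order the tangential part only reparametrizes the curve, so the Riemann
  map \<open>\<phi>t\<close> of the perturbed domain should be \<open>\<xi> = \<phi> + t \<phi>' z h\<close> up to \<open>O(t\<^sup>2)\<close>.

  No regularity of \<open>\<gamma>\<close> is available.  Instead, let \<open>F\<close> be the inverse of \<open>\<phi>t\<close> and \<open>\<Phi>\<close> the flow at time \<open>t\<close>,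
  and put \<open>p = F \<circ> \<xi>\<close>, defined on a smaller disc, and \<open>q = F \<circ> \<Phi> \<circ> \<phi>\<close>, defined near the unit circle, where
  \<open>|q| \<rightarrow> 1\<close>.  On two circles \<open>p\<close> and \<open>q\<close> agree up to the tangential displacement and a factor
  \<open>1 + O(t\<^sup>2)\<close>.  Three circles on the annulus for \<open>q\<close> and the maximum principle on the disc for
  \<open>p / z\<close> then force \<open>|p / z| = 1 + O(t\<^sup>2)\<close>; since \<open>p / z\<close> is positive at \<open>0\<close>, \<open>p = z + O(t\<^sup>2)\<close>, that is
  \<open>\<xi> = \<phi>t + O(t\<^sup>2)\<close>.
\<close>

section \<open>Maximum principle estimates\<close>

text \<open>The factors \<open>deriv \<phi>\<close> and \<open>h\<close> in \<open>\<xi>\<close> may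
  be unbounded near the unit circle, so \<open>p\<close> is used only where \<open>\<xi>\<close>
  surely lands in the perturbed domain. The field may be singular at 0, so \<open>q\<close> is
  confined to an annulus, and at the unit circle only its modulus is controlled. Dividing
  \<open>q\<close> by the tangential displacement \<open>\<Psi> t\<close> preserves that control,
  because for real t the displacement maps the unit circle to itself. This quotient is what is
  matched with \<open>p z / z\<close>. The two functions control each other through a fixed-point
  inequality. Let L be the logarithm of the maximum of |p / z|. If each passage between the
  functions costs a factor exp \<kappa> with \<kappa> = O(t^2), and three circles multiplies
  logarithms by \<theta> < 1, then L \<le> \<kappa> + \<theta> (\<kappa> + L). Hence L =
  O(\<kappa>), with a constant depending on radii only. Reciprocals obey the same inequality.
  Complex t serves the second-order estimates, where the Schwarz lemma in t replaces Taylor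
  remainders; the tangential property needs real t.\<close>

lemma bounded_holomorphic_lipschitz:
  fixes f :: "complex \<Rightarrow> complex"
  assumes hol: "f holomorphic_on ball a d" and bnd: "\<And>z. z \<in> ball a d \<Longrightarrow> cmod (f z) < B"
    and b: "cmod (b - a) < d"
  shows "cmod (f b - f a) \<le> 2 * B / d * cmod (b - a)"
proof -
  have d: "d > 0" using b norm_ge_zero[of "b - a"] by linarith
  then have B: "B > 0" using bnd[of a] by (smt (verit) centre_in_ball norm_ge_zero)
  have inb: "a + of_real d * z \<in> ball a d" if "cmod z < 1" for z
    using that d by (simp add: dist_norm norm_mult)
  \<comment> \<open>Division by \<open>2 * B\<close> makes this a self-map of the disc fixing 0. The
    resulting constant involves only \<open>B\<close> and \<open>d\<close>, so a bound for a family
    of functions gives an estimate uniform over the family.\<close>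
  define g where "g z = (f (a + of_real d * z) - f a) / of_real (2 * B)" for z
  have "cmod (g ((b - a) / of_real d)) \<le> cmod ((b - a) / of_real d)"
  proof (rule Schwarz_Lemma(1))
    have "(f \<circ> (\<lambda>z. a + of_real d * z)) holomorphic_on ball 0 1"
      by (rule holomorphic_on_compose_gen[OF _ hol]) (use inb in \<open>auto intro!: holomorphic_intros\<close>)
    then show "g holomorphic_on ball 0 1"
      unfolding g_def using B by (auto intro!: holomorphic_intros simp: o_def)
    show "g 0 = 0" by (simp add: g_def)
    show "cmod (g z) < 1" if "cmod z < 1" for z
    proof -
      have "cmod (f (a + of_real d * z) - f a) < B + B"
        by (rule order_le_less_trans[OF norm_triangle_ineq4])
           (intro add_strict_mono bnd inb that, use d in simp)
      then show ?thesis using B by (simp add: g_def norm_divide norm_mult)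
    qed
    show "cmod ((b - a) / of_real d) < 1" using b d by (simp add: norm_divide)
  qed
  then show ?thesis
    using B d by (simp add: g_def norm_divide norm_mult field_simps)
qed

text \<open>The double zero at t = 0 is split off in two steps, each by the Schwarz lemma: once for
  \<open>D\<close>, once for \<open>D t x / t\<close>, which vanishes at 0 because the derivative of
  \<open>D\<close> does. Compactness of \<open>S\<close> makes the bound uniform in
  \<open>x\<close>.\<close>

lemma uniform_quadratic_bound:
  fixes D :: "complex \<Rightarrow> 'a::topological_space \<Rightarrow> complex"
  assumes \<tau>: "\<tau> > 0" and S: "compact S"
    and cont: "continuous_on (cball 0 \<tau> \<times> S) (\<lambda>(t, x). D t x)"
    and hol: "\<And>x. x \<in> S \<Longrightarrow> (\<lambda>t. D t x) holomorphic_on ball 0 \<tau>"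
    and D0: "\<And>x. x \<in> S \<Longrightarrow> D 0 x = 0"
    and D1: "\<And>x. x \<in> S \<Longrightarrow> ((\<lambda>t. D t x) has_field_derivative 0) (at 0)"
  shows "\<exists>C>0. \<forall>x\<in>S. \<forall>t\<in>ball 0 \<tau>. cmod (D t x) \<le> C * (cmod t)\<^sup>2"
proof -
  have "bounded ((\<lambda>(t, x). D t x) ` (cball 0 \<tau> \<times> S))"
    by (intro compact_imp_bounded compact_continuous_image cont compact_Times compact_cball S)
  then obtain M where M: "M > 0" "\<And>t x. t \<in> cball 0 \<tau> \<Longrightarrow> x \<in> S \<Longrightarrow> cmod (D t x) < M"
    unfolding bounded_pos_less by fast
  \<comment> \<open>The added 1 makes the bound on the quotient strict, as the Schwarz estimate
    demands.\<close>
  define N where "N = 2 * M / \<tau> + 1"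
  have N: "N > 0" "2 * M / \<tau> < N" using M \<tau> by (auto simp: N_def add_nonneg_pos)
  have "cmod (D t x) \<le> 2 * N / \<tau> * (cmod t)\<^sup>2" if x: "x \<in> S" and t: "t \<in> ball 0 \<tau>" for x t
  proof -
    define E where "E t = (if t = 0 then deriv (\<lambda>t. D t x) 0 else D t x / t)" for t
    have E0: "E 0 = 0" using D1[OF x] by (simp add: E_def DERIV_imp_deriv)
    have holE: "E holomorphic_on ball 0 \<tau>"
      by (rule pole_theorem_open_0[OF hol[OF x], of 0]) (auto simp: E_def D0[OF x])
    have Eb: "cmod (E s) < N" if s: "s \<in> ball 0 \<tau>" for s
    proof (cases "s = 0")
      case False
      have "cmod (D s x - D 0 x) \<le> 2 * M / \<tau> * cmod (s - 0)"
        by (rule bounded_holomorphic_lipschitz[OF hol[OF x]]) (use M x s in auto)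
      then have "cmod (D s x) / cmod s \<le> 2 * M / \<tau>"
        using D0[OF x] False by (simp add: field_simps)
      then show ?thesis using False N by (simp add: E_def norm_divide)
    qed (use E0 N in simp)
    have "cmod (E t - E 0) \<le> 2 * N / \<tau> * cmod (t - 0)"
      by (rule bounded_holomorphic_lipschitz[OF holE]) (use Eb t in auto)
    then have "cmod (E t) * cmod t \<le> 2 * N / \<tau> * cmod t * cmod t"
      using E0 by (intro mult_right_mono) auto
    moreover have "D t x = E t * t" using D0[OF x] by (simp add: E_def)
    ultimately show ?thesis by (simp add: norm_mult power2_eq_square mult.assoc)
  qed
  then show ?thesis
    using N \<tau> by (intro exI[of _ "2 * N / \<tau>"]) auto
qed

text \<open>
  The comparison function \<open>|z| powr \<alpha>\<close> is replaced by rational \<open>\<alpha> = k / m\<close>, so that the maximum principle applies to the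
  single-valued function \<open>g ^ m * z ^ k\<close>.
\<close>
lemma three_circles_bound:
  fixes g :: "complex \<Rightarrow> complex"
  assumes \<rho>: "0 \<le> \<rho>0" "\<rho>0 < \<rho>" "\<rho> < 1" and b: "b \<ge> 0"
    and hol: "g holomorphic_on {z. \<rho>0 < cmod z \<and> cmod z < 1}"
    and bnd: "\<And>z. cmod z = \<rho> \<Longrightarrow> cmod (g z) \<le> exp b"
    and lim: "\<And>\<epsilon>. \<epsilon> > 0 \<Longrightarrow> \<exists>\<delta><1. \<forall>z. \<delta> < cmod z \<and> cmod z < 1 \<longrightarrow> cmod (g z) \<le> 1 + \<epsilon>"
    and z: "\<rho> \<le> cmod z" "cmod z < 1"
  shows "cmod (g z) \<le> exp (b * (ln (cmod z) / ln \<rho>))"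
proof (cases "g z = 0")
  case False
  define L where "L = - ln \<rho>"
  have L: "L > 0" using \<rho> by (simp add: L_def)
  have z0: "cmod z > 0" using z \<rho> by linarith
  \<comment> \<open>The condition says that exp b ^ m * \<rho> ^ k is at most 1, which is the
    required bound on the inner circle.\<close>
  have step: "cmod (g z) ^ m * cmod z ^ k \<le> 1" if mk: "real m * b \<le> real k * L" for m k
  proof -
    have *: "cmod (g z) ^ m * cmod z ^ k \<le> (1 + \<epsilon>) ^ m" if \<epsilon>: "\<epsilon> > 0" for \<epsilon> :: real
    proof -
      obtain \<delta> where \<delta>: "\<delta> < 1" "\<And>z. \<delta> < cmod z \<Longrightarrow> cmod z < 1 \<Longrightarrow> cmod (g z) \<le> 1 + \<epsilon>"
        using lim[OF \<epsilon>] by blast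
      \<comment> \<open>\<open>g\<close> has no boundary values at radius 1. The outer circle is
        therefore taken strictly inside the disc, close enough to radius 1 for the bound
        \<open>1 + \<epsilon>\<close> and beyond the given point.\<close>
      obtain \<sigma> where \<sigma>: "max \<delta> (cmod z) < \<sigma>" "\<sigma> < 1"
        using dense[of "max \<delta> (cmod z)" 1] \<delta> z by auto
      define S where "S = {x. \<rho> \<le> cmod x \<and> cmod x \<le> \<sigma>}"
      have clS: "closed S" unfolding S_def by (intro closed_Collect_conj closed_Collect_le continuous_intros)
      have sub: "S \<subseteq> {z. \<rho>0 < cmod z \<and> cmod z < 1}" using \<rho> \<sigma> by (auto simp: S_def)
      have holS: "(\<lambda>x. g x ^ m * x ^ k) holomorphic_on S"
        by (intro holomorphic_intros holomorphic_on_subset[OF hol sub])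
      have "cmod (g z ^ m * z ^ k) \<le> (1 + \<epsilon>) ^ m"
      proof (rule maximum_modulus_frontier[where S = S and f = "\<lambda>x. g x ^ m * x ^ k"])
        show "(\<lambda>x. g x ^ m * x ^ k) holomorphic_on interior S"
          by (rule holomorphic_on_subset[OF holS interior_subset])
        show "continuous_on (closure S) (\<lambda>x. g x ^ m * x ^ k)"
          using holS clS by (simp add: holomorphic_on_imp_continuous_on)
        show "bounded S" by (rule bounded_subset[of "cball 0 1"]) (use \<sigma> in \<open>auto simp: S_def\<close>)
        show "z \<in> S" using z \<sigma> by (simp add: S_def)
        fix x assume x: "x \<in> frontier S"
        have "{x. \<rho> < cmod x \<and> cmod x < \<sigma>} \<subseteq> interior S"
          by (rule interior_maximal) (auto simp: S_def intro!: open_Collect_conj open_Collect_less continuous_intros)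
        then have "\<not> (\<rho> < cmod x \<and> cmod x < \<sigma>)"
          using x by (auto simp: frontier_def)
        moreover have "x \<in> S"
          using x clS frontier_subset_closed by blast
        ultimately have "cmod x = \<rho> \<or> cmod x = \<sigma>"
          by (auto simp: S_def)
        then show "cmod (g x ^ m * x ^ k) \<le> (1 + \<epsilon>) ^ m"
        proof
          assume eq: "cmod x = \<rho>"
          have "cmod (g x ^ m * x ^ k) \<le> exp b ^ m * exp (- L) ^ k"
            unfolding norm_mult norm_power
            by (intro mult_mono power_mono bnd eq) (use eq \<rho> in \<open>auto simp: L_def\<close>)
          also have "\<dots> = exp (real m * b - real k * L)"
            by (simp add: exp_of_nat_mult[symmetric] exp_add[symmetric])
          also have "\<dots> \<le> 1" using mk by simp
          also have "\<dots> \<le> (1 + \<epsilon>) ^ m" using \<epsilon> by (intro one_le_power) simp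
          finally show ?thesis .
        next
          assume eq: "cmod x = \<sigma>"
          have "cmod (g x ^ m * x ^ k) \<le> (1 + \<epsilon>) ^ m * 1 ^ k"
            unfolding norm_mult norm_power
            by (intro mult_mono power_mono \<delta>) (use eq \<sigma> \<epsilon> in auto)
          then show ?thesis by simp
        qed
      qed
      then show ?thesis by (simp add: norm_mult norm_power)
    qed
    have "((\<lambda>\<epsilon>. (1 + \<epsilon>) ^ m) \<longlongrightarrow> (1 + 0) ^ m) (at_right (0::real))"
      by (intro tendsto_intros)
    then have "cmod (g z) ^ m * cmod z ^ k \<le> (1 + 0) ^ m"
      by (rule tendsto_lowerbound) (use * in \<open>auto simp: eventually_at_filter\<close>)
    then show ?thesis by simp
  qed
  define \<Lambda> where "\<Lambda> = - ln (cmod z)"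
  have \<Lambda>: "\<Lambda> > 0" using z z0 by (simp add: \<Lambda>_def)
  have "ln (cmod (g z)) \<le> (b / L + 1 / real (Suc m)) * \<Lambda>" for m
  proof -
    \<comment> \<open>The least admissible numerator for the denominator \<open>Suc m\<close>.
      Rounding up costs at most 1 / Suc m in the exponent, which disappears in the limit.\<close>
    define k where "k = nat \<lceil>real (Suc m) * b / L\<rceil>"
    have "real (Suc m) * b / L \<ge> 0" using b L by simp
    then have k: "real (Suc m) * b / L \<le> real k" "real k \<le> real (Suc m) * b / L + 1"
      unfolding k_def by linarith+
    then have "cmod (g z) ^ Suc m * cmod z ^ k \<le> 1"
      by (intro step) (use L in \<open>simp add: field_simps\<close>)
    then have "ln (cmod (g z) ^ Suc m * cmod z ^ k) \<le> ln 1"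
      using False z0 by (subst ln_le_cancel_iff) (auto simp del: power_Suc)
    then have "real (Suc m) * ln (cmod (g z)) \<le> real k * \<Lambda>"
      using False z0 by (simp add: ln_mult ln_realpow \<Lambda>_def del: power_Suc of_nat_Suc)
    also have "\<dots> \<le> (real (Suc m) * b / L + 1) * \<Lambda>"
      using k \<Lambda> by (intro mult_right_mono) auto
    also have "\<dots> = real (Suc m) * ((b / L + 1 / real (Suc m)) * \<Lambda>)"
      by (simp add: field_simps del: of_nat_Suc)
    finally show ?thesis
      by (subst (asm) mult_le_cancel_left_pos) auto
  qed
  moreover have "(\<lambda>m. (b / L + 1 / real (Suc m)) * \<Lambda>) \<longlonglongrightarrow> (b / L + 0) * \<Lambda>"
    by (intro tendsto_intros LIMSEQ_Suc[OF lim_1_over_n])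
  ultimately have "ln (cmod (g z)) \<le> (b / L + 0) * \<Lambda>"
    by (intro tendsto_lowerbound) auto
  then have "ln (cmod (g z)) \<le> b * (ln (cmod z) / ln \<rho>)"
    by (simp add: L_def \<Lambda>_def)
  then show ?thesis
    using False by (metis exp_le_cancel_iff exp_ln zero_less_norm_iff)
qed simp

text \<open>
  The exponent contracts by the factor \<open>\<theta> < 1\<close> from three circles on passing from \<open>g\<close> to \<open>r\<close>, and is
  not increased on passing back by the maximum principle for \<open>r\<close>.
\<close>
lemma annulus_contraction_bound:
  fixes g r :: "complex \<Rightarrow> complex"
  assumes \<rho>: "0 \<le> \<rho>0" "\<rho>0 < \<rho>1" "\<rho>1 < \<rho>1'" "\<rho>1' < 1" "0 < \<rho>2" "\<rho>2 < \<rho>3" and \<kappa>: "\<kappa> \<ge> 0"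
    and holr: "r holomorphic_on ball 0 \<rho>3"
    and holg: "g holomorphic_on {z. \<rho>0 < cmod z \<and> cmod z < 1}"
    and lim: "\<And>\<epsilon>. \<epsilon> > 0 \<Longrightarrow> \<exists>\<delta><1. \<forall>z. \<delta> < cmod z \<and> cmod z < 1 \<longrightarrow> cmod (g z) \<le> 1 + \<epsilon>"
    and gr: "\<And>z. cmod z = \<rho>1 \<Longrightarrow> \<exists>z'. cmod z' \<le> \<rho>2 \<and> cmod (g z) \<le> exp \<kappa> * cmod (r z')"
    and rg: "\<And>z. cmod z = \<rho>2 \<Longrightarrow> \<exists>z'. \<rho>1' \<le> cmod z' \<and> cmod z' < 1 \<and> cmod (r z) \<le> exp \<kappa> * cmod (g z')"
    and z: "cmod z \<le> \<rho>2"
  defines "\<theta> \<equiv> ln \<rho>1' / ln \<rho>1"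
  shows "cmod (r z) \<le> exp (\<kappa> * ((1 + \<theta>) / (1 - \<theta>)))"
proof -
  have \<theta>: "0 < \<theta>" "\<theta> < 1" using \<rho> by (auto simp: \<theta>_def field_simps)
  have contr: "continuous_on (cball 0 \<rho>2) r"
    by (rule holomorphic_on_imp_continuous_on, rule holomorphic_on_subset[OF holr]) (use \<rho> in auto)
  have "\<exists>x\<in>sphere 0 \<rho>2. \<forall>y\<in>sphere 0 \<rho>2. cmod (r y) \<le> cmod (r x)"
    by (rule continuous_attains_sup)
       (use \<rho> contr in \<open>auto intro!: continuous_intros elim!: continuous_on_subset\<close>)
  then obtain x where x: "cmod x = \<rho>2" "\<And>y. cmod y = \<rho>2 \<Longrightarrow> cmod (r y) \<le> cmod (r x)"
    by auto
  define \<mu> where "\<mu> = cmod (r x)"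
  have max: "cmod (r y) \<le> \<mu>" if "cmod y \<le> \<rho>2" for y
  proof (rule maximum_modulus_frontier[where S = "cball 0 \<rho>2" and f = r])
    show "r holomorphic_on interior (cball 0 \<rho>2)"
      by (rule holomorphic_on_subset[OF holr]) (use \<rho> in auto)
  qed (use that x \<rho> contr in \<open>auto simp: \<mu>_def\<close>)
  have "\<mu> \<le> exp (\<kappa> * ((1 + \<theta>) / (1 - \<theta>)))"
  proof (cases "\<mu> \<le> 1")
    case True
    then show ?thesis using \<kappa> \<theta> by (smt (verit) one_le_exp_iff divide_nonneg_pos mult_nonneg_nonneg)
  next
    case False
    \<comment> \<open>Three circles wants a nonnegative exponent on the inner circle. This is why
      the case \<open>\<mu> \<le> 1\<close>, where the claim is immediate, was separated.\<close>
    define b where "b = \<kappa> + ln \<mu>"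
    have b: "b \<ge> 0" using False \<kappa> by (simp add: b_def)
    have gb: "cmod (g y) \<le> exp b" if y: "cmod y = \<rho>1" for y
    proof -
      obtain z' where "cmod z' \<le> \<rho>2" "cmod (g y) \<le> exp \<kappa> * cmod (r z')" using gr[OF y] by blast
      then have "cmod (g y) \<le> exp \<kappa> * \<mu>" using max by (meson mult_left_mono exp_ge_zero order_trans)
      then show ?thesis using False by (simp add: b_def exp_add)
    qed
    obtain z' where z': "\<rho>1' \<le> cmod z'" "cmod z' < 1" "\<mu> \<le> exp \<kappa> * cmod (g z')"
      using rg[OF x(1)] by (auto simp: \<mu>_def)
    have "cmod (g z') \<le> exp (b * (ln (cmod z') / ln \<rho>1))"
      by (rule three_circles_bound[OF _ _ _ b holg gb lim]) (use \<rho> z' in auto)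
    also have "\<dots> \<le> exp (b * \<theta>)"
    proof -
      have "ln (cmod z') / ln \<rho>1 \<le> \<theta>"
        unfolding \<theta>_def
      proof (rule divide_right_mono_neg)
        show "ln \<rho>1' \<le> ln (cmod z')" using z' \<rho> by (subst ln_le_cancel_iff) linarith+
        show "ln \<rho>1 \<le> 0" using \<rho> by simp
      qed
      then show ?thesis using b by (simp only: exp_le_cancel_iff mult_left_mono)
    qed
    finally have "\<mu> \<le> exp \<kappa> * exp (b * \<theta>)"
      using z'(3) by (meson mult_left_mono exp_ge_zero order_trans)
    then have "\<mu> \<le> exp (\<kappa> + b * \<theta>)" by (simp add: exp_add)
    then have "ln \<mu> \<le> \<kappa> + b * \<theta>"
      using False by (smt (verit) ln_exp ln_le_cancel_iff exp_gt_zero)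
    \<comment> \<open>The inequality ln \<mu> \<le> \<kappa> + \<theta> (\<kappa> + ln \<mu>) solved
      for ln \<mu>.\<close>
    then have "ln \<mu> \<le> \<kappa> * ((1 + \<theta>) / (1 - \<theta>))"
      using \<theta> by (simp add: b_def field_simps)
    then show ?thesis
      using False by (smt (verit) exp_le_cancel_iff exp_ln)
  qed
  then show ?thesis using max[OF z] by simp
qed

text \<open>A function whose modulus at the centre is almost its maximum is almost constant, by
  Schwarz-Pick. The value at the centre being real and positive excludes constants of modulus 1
  other than 1.\<close>

lemma schwarz_pick_near_one:
  fixes r :: "complex \<Rightarrow> complex"
  assumes \<rho>: "\<rho> > 0" and hol: "r holomorphic_on ball 0 \<rho>"
    and bnd: "\<And>z. cmod z < \<rho> \<Longrightarrow> cmod (r z) \<le> exp \<kappa>"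
    and r0: "r 0 = of_real x" and x: "exp (- \<kappa>) \<le> x"
    and \<kappa>: "0 < \<kappa>" "\<kappa> \<le> 1 / 4" and \<sigma>: "\<sigma> < 1" and z: "cmod z \<le> \<sigma> * \<rho>"
  shows "cmod (r z - 1) \<le> 16 / (1 - \<sigma>) * \<kappa>"
proof -
  have \<sigma>0: "\<sigma> \<ge> 0" using z \<rho> by (meson norm_ge_zero order_trans zero_le_mult_iff not_less)
  \<comment> \<open>Larger than the given bound exp \<kappa>, so that \<open>r / K\<close> maps into
    the open disc. With \<open>\<kappa> \<le> 1 / 4\<close> the exponent is at most 1/2, where exp
    is bounded linearly.\<close>
  define K where "K = exp (2 * \<kappa>)"
  have K: "K > 1" using \<kappa> by (simp add: K_def)
  have K2: "K \<le> 1 + 4 * \<kappa>" using exp_bound_lemma[of "2 * \<kappa>"] \<kappa> by (simp add: K_def)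
  have rK: "cmod (r z) < K" if "cmod z < \<rho>" for z
    using bnd[OF that] \<kappa> by (smt (verit) K_def exp_less_cancel_iff)
  have xpos: "x > 0" using x by (smt (verit) exp_gt_zero)
  define a where "a = x / K"
  have a1: "a < 1" using rK[of 0] r0 \<rho> K xpos by (simp add: a_def)
  have a0: "a > 0" using xpos K by (simp add: a_def)
  have "a \<ge> exp (- 3 * \<kappa>)"
  proof -
    have "exp (- 3 * \<kappa>) * K = exp (- \<kappa>)" by (simp add: K_def exp_add[symmetric])
    then show ?thesis using x K by (simp add: a_def field_simps)
  qed
  then have a3: "1 - a \<le> 3 * \<kappa>" using exp_ge_add_one_self[of "- 3 * \<kappa>"] by linarith
  define f where "f u = r (of_real \<rho> * u) / of_real K" for u
  have f1: "cmod (f u) < 1" if "cmod u < 1" for u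
    using rK[of "of_real \<rho> * u"] that \<rho> K by (simp add: f_def norm_divide norm_mult)
  have holf: "f holomorphic_on ball 0 1"
  proof -
    have "(r \<circ> (\<lambda>u. of_real \<rho> * u)) holomorphic_on ball 0 1"
      by (rule holomorphic_on_compose_gen[OF _ hol]) (use \<rho> in \<open>auto intro!: holomorphic_intros simp: norm_mult\<close>)
    then show ?thesis unfolding f_def using K by (auto intro!: holomorphic_intros simp: o_def)
  qed
  have aw: "cmod (of_real a) < 1" using a0 a1 by simp
  define M where "M u = Moebius_function 0 (of_real a) (f u)" for u
  define u where "u = z / of_real \<rho>"
  have u: "cmod u \<le> \<sigma>" "cmod u < 1" "f u = r z / of_real K"
    using z \<rho> \<sigma> by (auto simp: u_def f_def norm_divide field_simps intro: order_le_less_trans)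
  have "cmod (M u) \<le> cmod u"
  proof (rule Schwarz_Lemma(1))
    have "(Moebius_function 0 (of_real a) \<circ> f) holomorphic_on ball 0 1"
      by (rule holomorphic_on_compose_gen[OF holf Moebius_function_holomorphic[OF aw]]) (use f1 in auto)
    then show "M holomorphic_on ball 0 1" by (simp add: M_def[abs_def] o_def)
    show "M 0 = 0" using r0 by (simp add: M_def f_def Moebius_function_simple a_def)
    show "cmod (M z) < 1" if "cmod z < 1" for z
      unfolding M_def by (rule Moebius_function_norm_lt_1[OF aw f1[OF that]])
  qed (rule u)
  define d where "d = cmod (f u - of_real a)"
  have nz: "cmod (1 - of_real a * f u) > 0"
    using f1[OF u(2)] a0 a1 by (auto dest!: arg_cong[of _ _ cmod] simp: norm_mult) (smt (verit) mult_less_cancel_left2)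
  have "cmod (M u) = d / cmod (1 - of_real a * f u)"
    by (simp add: M_def Moebius_function_simple d_def norm_divide)
  then have "d \<le> \<sigma> * cmod (1 - of_real a * f u)"
    using \<open>cmod (M u) \<le> cmod u\<close> u(1) nz by (simp add: divide_le_eq) (meson mult_right_mono norm_ge_zero order_trans)
  \<comment> \<open>The denominator of the Moebius transformation is itself expressed through
    \<open>d\<close>. The Schwarz inequality then becomes linear in \<open>d\<close> and can be
    solved because \<open>\<sigma> < 1\<close>.\<close>
  also have "cmod (1 - of_real a * f u) \<le> (1 - a\<^sup>2) + a * d"
  proof -
    have "1 - of_real a * f u = of_real (1 - a\<^sup>2) - of_real a * (f u - of_real a)"
      by (simp add: algebra_simps power2_eq_square)
    also have "cmod \<dots> \<le> cmod (of_real (1 - a\<^sup>2)) + cmod (of_real a * (f u - of_real a))"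
      by (rule norm_triangle_ineq4)
    also have "\<dots> = (1 - a\<^sup>2) + a * d"
      using a0 a1 unfolding d_def norm_mult norm_of_real by (simp add: power_le_one)
    finally show ?thesis .
  qed
  also have "\<dots> \<le> 2 * (1 - a) + 1 * d"
  proof -
    have "1 - a\<^sup>2 = (1 + a) * (1 - a)" by (simp add: algebra_simps power2_eq_square)
    also have "\<dots> \<le> 2 * (1 - a)" using a1 by (intro mult_right_mono) auto
    moreover have "a * d \<le> 1 * d" using a1 by (intro mult_right_mono) (auto simp: d_def)
    ultimately show ?thesis by linarith
  qed
  finally have "d \<le> \<sigma> * (2 * (1 - a) + d)" using \<sigma>0 by (simp add: mult_left_mono)
  then have "d * (1 - \<sigma>) \<le> \<sigma> * (2 * (1 - a))" by (simp add: algebra_simps)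
  also have "\<dots> \<le> 1 * (6 * \<kappa>)" using \<sigma> \<sigma>0 a1 a3 by (rule_tac mult_mono) auto
  finally have d: "d \<le> 6 * \<kappa> / (1 - \<sigma>)" using \<sigma> by (simp add: field_simps)
  \<comment> \<open>The constant 16 is 12 + 4: twice the 6 in the bound for \<open>d\<close>, as
    \<open>K \<le> 2\<close>, plus 4 from \<bar>x - 1\<bar>.\<close>
  have "r z - 1 = of_real K * (f u - of_real a) + of_real (x - 1)"
    using K by (simp add: u(3) a_def field_simps)
  also have "cmod \<dots> \<le> K * d + \<bar>x - 1\<bar>"
    unfolding d_def using K by (intro order_trans[OF norm_triangle_ineq]) (simp add: norm_mult del: of_real_diff)
  also have "\<bar>x - 1\<bar> \<le> 4 * \<kappa>"
    using a1 K K2 x exp_ge_add_one_self[of "- \<kappa>"] \<kappa> by (simp add: a_def abs_le_iff)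
  also have "K * d \<le> 2 * (6 * \<kappa> / (1 - \<sigma>))"
    using K K2 \<kappa> d by (intro mult_mono) (auto simp: d_def)
  also have "4 * \<kappa> \<le> 4 * \<kappa> / (1 - \<sigma>)"
    using \<sigma> \<sigma>0 \<kappa> by (simp add: field_simps)
  finally show ?thesis by (simp add: field_simps)
qed

text \<open>Turns an additive error into factors usable in both directions. The doubling pays for
  the lower bound, since 1 / (1 - e) is at most 1 + 2 e for e between 0 and 1/2.\<close>

lemma cmod_bounds_exp:
  assumes "cmod (x - 1) \<le> e" "e \<le> 1 / 2"
  shows "cmod x \<le> exp (2 * e)" "1 \<le> exp (2 * e) * cmod x"
proof -
  have e: "e \<ge> 0" using assms(1) norm_ge_zero[of "x - 1"] by linarith
  have "cmod x \<le> 1 + e" using norm_triangle_sub[of x 1] assms by simp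
  also have "\<dots> \<le> exp e" by (rule exp_ge_add_one_self)
  also have "\<dots> \<le> exp (2 * e)" using e by simp
  finally show "cmod x \<le> exp (2 * e)" .
  have "1 - e \<le> cmod x" using norm_triangle_sub[of 1 x] assms by (simp add: norm_minus_commute)
  have "0 \<le> e * (1 - 2 * e)" using e assms by simp
  then have "1 \<le> (1 + 2 * e) * (1 - e)" by (simp add: algebra_simps)
  also have "\<dots> \<le> exp (2 * e) * cmod x"
    using exp_ge_add_one_self[of "2 * e"] \<open>1 - e \<le> cmod x\<close> assms e by (intro mult_mono) auto
  finally show "1 \<le> exp (2 * e) * cmod x" .
qed

text \<open>Uniform continuity on a closed annulus, applied to a point and its radial projection to
  the unit circle.\<close>

lemma cmod_near_unit_circle:
  assumes cont: "continuous_on (- {0}) v" and circ: "\<And>z. cmod z = 1 \<Longrightarrow> cmod (v z) = 1" and \<epsilon>: "\<epsilon> > 0"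
  obtains \<delta> where "\<delta> < 1" "\<And>z. \<delta> < cmod z \<Longrightarrow> cmod z < 1 \<Longrightarrow> \<bar>cmod (v z) - 1\<bar> < \<epsilon>"
proof -
  define S :: "complex set" where "S = cball 0 1 - ball 0 (1/2)"
  have "uniformly_continuous_on S v"
    by (rule compact_uniformly_continuous)
       (auto simp: S_def intro!: compact_diff continuous_on_subset[OF cont])
  then obtain d where d: "d > 0" "\<And>z z'. z \<in> S \<Longrightarrow> z' \<in> S \<Longrightarrow> dist z' z < d \<Longrightarrow> dist (v z') (v z) < \<epsilon>"
    unfolding uniformly_continuous_on_def using \<epsilon> by metis
  show thesis
  proof (rule that)
    show "max (1/2) (1 - d) < 1" using d by simp
    fix z assume z: "max (1/2) (1 - d) < cmod z" "cmod z < 1"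
    define z' where "z' = z / of_real (cmod z)"
    have z': "cmod z' = 1" using z by (auto simp: z'_def norm_divide)
    have "of_real (cmod z) * z' = z" using z by (auto simp: z'_def)
    then have "z' - z = of_real (1 - cmod z) * z'" by (simp add: left_diff_distrib)
    then have "dist z' z = 1 - cmod z" using z z' by (simp add: dist_norm norm_mult del: of_real_diff)
    then have "dist (v z') (v z) < \<epsilon>" using d(2)[of z z'] z z' by (auto simp: S_def)
    then show "\<bar>cmod (v z) - 1\<bar> < \<epsilon>"
      using circ[OF z'] norm_triangle_ineq3[of "v z'" "v z"] by (simp add: dist_norm)
  qed
qed

text \<open>
  Both \<open>p z / z\<close> and its reciprocal satisfy the contraction estimate, with \<open>q z / v z\<close> on the annulus.
\<close>
lemma compared_on_circles_near_identity:
  fixes p q v :: "complex \<Rightarrow> complex"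
  assumes \<rho>: "0 \<le> \<rho>0" "\<rho>0 < \<rho>1" "\<rho>1 < \<rho>1'" "\<rho>1' < 1" "0 < \<rho>2" "\<rho>2 < \<rho>3"
    and p: "p holomorphic_on ball 0 \<rho>3" "p 0 = 0" "\<And>z. 0 < cmod z \<Longrightarrow> cmod z < \<rho>3 \<Longrightarrow> p z \<noteq> 0"
      "deriv p 0 = of_real x" "x > 0"
    and q: "q holomorphic_on {z. \<rho>0 < cmod z \<and> cmod z < 1}"
      "\<And>z. \<rho>0 < cmod z \<Longrightarrow> cmod z < 1 \<Longrightarrow> q z \<noteq> 0 \<and> cmod (q z) < 1"
      "\<And>\<epsilon>. \<epsilon> > 0 \<Longrightarrow> \<epsilon> < 1 \<Longrightarrow> \<exists>\<delta><1. \<forall>z. \<delta> < cmod z \<and> cmod z < 1 \<longrightarrow> 1 - \<epsilon> < cmod (q z)"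
    and v: "v holomorphic_on - {0}" "\<And>z. z \<noteq> 0 \<Longrightarrow> v z \<noteq> 0" "\<And>z. cmod z = 1 \<Longrightarrow> cmod (v z) = 1"
    and gr: "\<And>z. cmod z = \<rho>1 \<Longrightarrow> cmod (v z) \<le> \<rho>2 \<and>
       cmod (q z) \<le> exp \<kappa> * cmod (p (v z)) \<and> cmod (p (v z)) \<le> exp \<kappa> * cmod (q z)"
    and rg: "\<And>z. cmod z = \<rho>2 \<Longrightarrow> \<exists>z'. \<rho>1' \<le> cmod z' \<and> cmod z' < 1 \<and>
       cmod (p z / z) \<le> exp \<kappa> * cmod (q z' / v z') \<and> cmod (q z' / v z') \<le> exp \<kappa> * cmod (p z / z)"
    and E: "E = (1 + ln \<rho>1' / ln \<rho>1) / (1 - ln \<rho>1' / ln \<rho>1)"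
    and \<kappa>: "0 < \<kappa>" "\<kappa> * E \<le> 1 / 4" and \<sigma>: "\<sigma> < 1" and z: "cmod z \<le> \<sigma> * \<rho>2"
  shows "cmod (p z - z) \<le> 16 / (1 - \<sigma>) * (\<kappa> * E) * cmod z"
proof -
  define r where "r z = (if z = 0 then deriv p 0 else p z / z)" for z
  have rz: "r z = p z / z" if "z \<noteq> 0" for z using that by (simp add: r_def)
  have holr: "r holomorphic_on ball 0 \<rho>3"
    by (rule pole_theorem_open_0[OF p(1), of 0]) (auto simp: r_def p(2))
  have rnz: "r z \<noteq> 0" if "z \<in> ball 0 \<rho>3" for z
    using that p(3)[of z] p(4,5) by (auto simp: r_def)
  define g where "g z = q z / v z" for z
  have sub: "{z. \<rho>0 < cmod z \<and> cmod z < 1} \<subseteq> - {0}" using \<rho> by auto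
  have holg: "g holomorphic_on {z. \<rho>0 < cmod z \<and> cmod z < 1}"
  proof -
    have "(\<lambda>z. q z / v z) holomorphic_on {z. \<rho>0 < cmod z \<and> cmod z < 1}"
    proof (rule holomorphic_on_divide[OF q(1) holomorphic_on_subset[OF v(1) sub]])
      show "v z \<noteq> 0" if "z \<in> {z. \<rho>0 < cmod z \<and> cmod z < 1}" for z
        by (rule v(2)) (use that \<rho>(1) in auto)
    qed
    then show ?thesis by (simp only: g_def[abs_def])
  qed
  have gnz: "g z \<noteq> 0" if "\<rho>0 < cmod z" "cmod z < 1" for z
  proof -
    have "z \<noteq> 0" using that \<rho> by auto
    then show ?thesis using q(2)[OF that] v(2) by (simp add: g_def)
  qed
  have contv: "continuous_on (- {0}) v" by (rule holomorphic_on_imp_continuous_on[OF v(1)])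
  have lim: "\<exists>\<delta><1. \<forall>z. \<delta> < cmod z \<and> cmod z < 1 \<longrightarrow> cmod (g z) \<le> 1 + \<epsilon>" if \<epsilon>: "\<epsilon> > 0" for \<epsilon>
  proof -
    obtain \<delta> where \<delta>: "\<delta> < 1" "\<And>z. \<delta> < cmod z \<Longrightarrow> cmod z < 1 \<Longrightarrow> \<bar>cmod (v z) - 1\<bar> < 1 - 1 / (1 + \<epsilon>)"
      by (rule cmod_near_unit_circle[OF contv v(3), of "1 - 1 / (1 + \<epsilon>)"]) (use \<epsilon> in auto)
    have "cmod (g z) \<le> 1 + \<epsilon>" if z: "max \<delta> \<rho>0 < cmod z" "cmod z < 1" for z
    proof -
      have vz: "1 / (1 + \<epsilon>) \<le> cmod (v z)" using \<delta>(2)[of z] z by (simp add: abs_less_iff)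
      have "cmod (q z) \<le> 1" using q(2)[of z] z by simp
      also have "1 \<le> (1 + \<epsilon>) * cmod (v z)" using vz \<epsilon> by (simp add: field_simps)
      finally show ?thesis using vz \<epsilon> by (simp add: g_def norm_divide divide_le_eq)
    qed
    then show ?thesis using \<delta> \<rho> by (intro exI[of _ "max \<delta> \<rho>0"]) auto
  qed
  have lim': "\<exists>\<delta><1. \<forall>z. \<delta> < cmod z \<and> cmod z < 1 \<longrightarrow> cmod (inverse (g z)) \<le> 1 + \<epsilon>" if \<epsilon>: "\<epsilon> > 0" for \<epsilon>
  proof -
    \<comment> \<open>The tolerance is shared equally: |v| is at most \<eta> and |q| is at least 1 /
      \<eta>.\<close>
    define \<eta> where "\<eta> = sqrt (1 + \<epsilon>)"
    have \<eta>: "\<eta> > 1" "\<eta> * \<eta> = 1 + \<epsilon>" using \<epsilon> by (auto simp: \<eta>_def)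
    obtain \<delta> where \<delta>: "\<delta> < 1" "\<And>z. \<delta> < cmod z \<Longrightarrow> cmod z < 1 \<Longrightarrow> \<bar>cmod (v z) - 1\<bar> < \<eta> - 1"
      by (rule cmod_near_unit_circle[OF contv v(3), of "\<eta> - 1"]) (use \<eta> in auto)
    obtain \<delta>' where \<delta>': "\<delta>' < 1" "\<And>z. \<delta>' < cmod z \<Longrightarrow> cmod z < 1 \<Longrightarrow> 1 - (1 - 1 / \<eta>) < cmod (q z)"
      using q(3)[of "1 - 1 / \<eta>"] \<eta> by auto
    have "cmod (inverse (g z)) \<le> 1 + \<epsilon>" if z: "max \<delta> \<delta>' < cmod z" "cmod z < 1" for z
    proof -
      have q1: "1 < \<eta> * cmod (q z)" using \<delta>'(2)[of z] z \<eta> by (simp add: field_simps)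
      have "cmod (v z) \<le> \<eta>" using \<delta>(2)[of z] z by (simp add: abs_less_iff)
      also have "\<dots> * 1 \<le> \<eta> * (\<eta> * cmod (q z))" using q1 \<eta> by (intro mult_left_mono) auto
      finally have "cmod (v z) \<le> (1 + \<epsilon>) * cmod (q z)" using \<eta>(2) by (simp add: mult.assoc[symmetric])
      moreover have "cmod (q z) > 0" using q1 by (cases "q z = 0") auto
      ultimately show ?thesis by (simp add: g_def norm_divide norm_inverse divide_le_eq)
    qed
    then show ?thesis using \<delta> \<delta>' by (intro exI[of _ "max \<delta> \<delta>'"]) auto
  qed
  have inv_le: "cmod (inverse a) \<le> exp \<kappa> * cmod (inverse b)" if "cmod b \<le> exp \<kappa> * cmod a" "a \<noteq> 0" "b \<noteq> 0" for a b :: complex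
    unfolding norm_inverse using that by (simp add: field_simps)
  have gr': "cmod (v z) \<le> \<rho>2 \<and> cmod (g z) \<le> exp \<kappa> * cmod (r (v z)) \<and> cmod (r (v z)) \<le> exp \<kappa> * cmod (g z)"
    if z: "cmod z = \<rho>1" for z
  proof -
    have "z \<noteq> 0" using z \<rho> by auto
    then have "v z \<noteq> 0" by (rule v(2))
    then show ?thesis using gr[OF z] by (simp add: g_def rz norm_divide divide_right_mono)
  qed
  have rg': "\<exists>z'. \<rho>1' \<le> cmod z' \<and> cmod z' < 1 \<and> cmod (r z) \<le> exp \<kappa> * cmod (g z') \<and> cmod (g z') \<le> exp \<kappa> * cmod (r z)"
    if z: "cmod z = \<rho>2" for z
  proof -
    have "z \<noteq> 0" using z \<rho> by auto
    then show ?thesis using rg[OF z] by (simp add: g_def rz)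
  qed
  have up: "cmod (r z) \<le> exp (\<kappa> * E)" if "cmod z \<le> \<rho>2" for z
    unfolding E
    by (rule annulus_contraction_bound[OF \<rho> _ holr holg lim _ _ that]) (use \<kappa> gr' rg' in blast | simp add: less_imp_le[OF \<kappa>(1)])+
  have low: "cmod (inverse (r z)) \<le> exp (\<kappa> * E)" if "cmod z \<le> \<rho>2" for z
    unfolding E
  proof (rule annulus_contraction_bound[OF \<rho> _ _ _ lim' _ _ that])
    show "(\<lambda>z. inverse (r z)) holomorphic_on ball 0 \<rho>3"
      by (intro holomorphic_intros holr rnz)
    show "(\<lambda>z. inverse (g z)) holomorphic_on {z. \<rho>0 < cmod z \<and> cmod z < 1}"
      by (intro holomorphic_intros holg) (use gnz in auto)
    show "\<exists>z'. cmod z' \<le> \<rho>2 \<and> cmod (inverse (g z)) \<le> exp \<kappa> * cmod (inverse (r z'))" if z: "cmod z = \<rho>1" for z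
      using gr'[OF z] rnz[of "v z"] gnz[of z] z \<rho> by (intro exI[of _ "v z"] conjI inv_le) auto
    show "\<exists>z'. \<rho>1' \<le> cmod z' \<and> cmod z' < 1 \<and> cmod (inverse (r z)) \<le> exp \<kappa> * cmod (inverse (g z'))" if z: "cmod z = \<rho>2" for z
    proof -
      obtain z' where z': "\<rho>1' \<le> cmod z'" "cmod z' < 1" "cmod (g z') \<le> exp \<kappa> * cmod (r z)"
        using rg'[OF z] by blast
      then show ?thesis
        using rnz[of z] gnz[of z'] z \<rho> by (intro exI[of _ "z'"] conjI inv_le) auto
    qed
  qed (use \<kappa> in auto)
  have E0: "E > 0"
  proof -
    have "0 < ln \<rho>1' / ln \<rho>1" "ln \<rho>1' / ln \<rho>1 < 1" using \<rho> by (auto simp: field_simps)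
    then show ?thesis unfolding E by auto
  qed
  have "cmod (r z - 1) \<le> 16 / (1 - \<sigma>) * (\<kappa> * E)"
  proof (rule schwarz_pick_near_one[OF \<rho>(5) _ _ _ _ _ \<kappa>(2) \<sigma> z])
    show "r holomorphic_on ball 0 \<rho>2" by (rule holomorphic_on_subset[OF holr]) (use \<rho> in auto)
    show "r 0 = of_real x" by (simp add: r_def p(4))
    \<comment> \<open>The reciprocal estimate enters here, evaluated at the centre: a lower bound
      for the derivative of \<open>p\<close> at 0.\<close>
    show "exp (- (\<kappa> * E)) \<le> x"
    proof -
      have "inverse x \<le> exp (\<kappa> * E)"
        using low[of 0] p(4,5) \<rho> by (simp add: r_def norm_inverse)
      then show ?thesis using p(5) by (simp add: exp_minus field_simps)
    qed
  qed (use up \<kappa> E0 in auto)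
  then have "cmod (r z - 1) * cmod z \<le> 16 / (1 - \<sigma>) * (\<kappa> * E) * cmod z" by (intro mult_right_mono) auto
  moreover have "p z - z = (r z - 1) * z" using p(2) by (cases "z = 0") (auto simp: rz field_simps)
  ultimately show ?thesis by (simp add: norm_mult)
qed

section \<open>Laurent coefficients\<close>

lemma laurent_coeff_eqI: "f has_laurent_expansion F \<Longrightarrow> laurent_coeff f = fls_nth F"
  by (simp add: laurent_coeff_def laurent_expansion_0_eqI)

text \<open>The value of \<open>f\<close> at \<open>0\<close> is irrelevant, so \<open>m\<close> may be negative.\<close>
lemma laurent_expansion_powi_mult:
  assumes holH: "H holomorphic_on ball 0 1"
    and f: "\<And>z. 0 < cmod z \<Longrightarrow> cmod z < 1 \<Longrightarrow> f z = z powi m * H z"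
  shows "f has_laurent_expansion fls_shift (- m) (fps_to_fls (fps_expansion H 0))"
    and "k < m \<Longrightarrow> laurent_coeff f k = 0"
    and "0 < cmod z \<Longrightarrow> cmod z < 1 \<Longrightarrow> ((\<lambda>k. laurent_coeff f k * z powi k) has_sum f z) {m..}"
proof -
  define B where "B = fps_expansion H 0"
  have "H analytic_on {0}"
    using holH by (auto simp: analytic_at intro!: exI[of _ "ball 0 1"])
  then have "H has_fps_expansion B"
    unfolding B_def using analytic_at_imp_has_fps_expansion[of H 0] by simp
  then have "(\<lambda>z. z powi m * H z) has_laurent_expansion fls_X_intpow m * fps_to_fls B"
    by (intro laurent_expansion_intros has_laurent_expansion_fps)
  also have "?this \<longleftrightarrow> f has_laurent_expansion fls_shift (- m) (fps_to_fls B)"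
    by (intro has_laurent_expansion_cong eventually_mono[OF eventually_at_in_open[of "ball 0 1"]])
       (auto simp: f fls_X_intpow_times_conv_shift)
  finally show exp: "f has_laurent_expansion fls_shift (- m) (fps_to_fls (fps_expansion H 0))"
    unfolding B_def .
  have c: "laurent_coeff f k = (if k < m then 0 else fps_nth B (nat (k - m)))" for k
    using laurent_coeff_eqI[OF exp] by (simp add: B_def)
  then show "k < m \<Longrightarrow> laurent_coeff f k = 0" by simp
  have holH': "H holomorphic_on eball 0 1"
    using holH by (simp add: eball_def ball_def one_ereal_def)
  have rad: "fps_conv_radius B \<ge> 1"
    using conv_radius_fps_expansion[OF holH'] by (simp add: B_def)
  assume z: "0 < cmod z" "cmod z < 1"
  have zr: "ereal (cmod z) < fps_conv_radius B"
    using rad z by (metis ereal_less(3) less_le_trans)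
  have "((\<lambda>k. fps_nth B k * z ^ k) has_sum H z) UNIV"
  proof (rule norm_summable_imp_has_sum)
    show "summable (\<lambda>k. cmod (fps_nth B k * z ^ k))"
      using abs_summable_in_conv_radius[of z "fps_nth B"] zr by (simp add: fps_conv_radius_def)
    show "(\<lambda>k. fps_nth B k * z ^ k) sums H z"
      using sums_eval_fps[OF zr] eval_fps_expansion'[OF holH', of z] z by (simp add: B_def one_ereal_def)
  qed
  then have "((\<lambda>k. z powi m * (fps_nth B k * z ^ k)) has_sum f z) UNIV"
    unfolding f[OF z] by (rule has_sum_cmult_right)
  also have "?this \<longleftrightarrow> ((\<lambda>k. laurent_coeff f k * z powi k) has_sum f z) {m..}"
    by (rule has_sum_reindex_bij_witness[of _ "\<lambda>k. nat (k - m)" "\<lambda>k. int k + m"])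
       (use z in \<open>auto simp: c power_int_add\<close>)
  finally show "((\<lambda>k. laurent_coeff f k * z powi k) has_sum f z) {m..}" .
qed

lemma laurent_coeff_powi_mult:
  assumes "f has_laurent_expansion F"
  shows "laurent_coeff (\<lambda>z. z powi j * f z) k = laurent_coeff f (k - j)"
proof -
  have "(\<lambda>z. z powi j * f z) has_laurent_expansion fls_X_intpow j * F"
    by (intro laurent_expansion_intros assms)
  then show ?thesis
    using assms by (simp add: laurent_coeff_eqI fls_X_intpow_times_conv_shift)
qed

lemma Res0_eq_laurent_coeff: "Res0 f = laurent_coeff f (- 1)"
  by (simp add: Res0_def laurent_coeff_def)

text \<open>
  \<open>Re (w z) = 0\<close> means that the vector field \<open>z * w z\<close> is tangential to the unit circle at \<open>z\<close>.
\<close>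
lemma laurent_split:
  fixes c :: "int \<Rightarrow> complex"
  assumes c0: "\<And>k. k < m \<Longrightarrow> c k = 0"
    and sum: "\<And>z. 0 < cmod z \<Longrightarrow> cmod z < 1 \<Longrightarrow> ((\<lambda>k. c k * z powi k) has_sum f z) {m..}"
  obtains h w where "h holomorphic_on ball 0 1" "w holomorphic_on - {0}"
    "\<And>z. cmod z = 1 \<Longrightarrow> Re (w z) = 0"
    "\<And>z. 0 < cmod z \<Longrightarrow> cmod z < 1 \<Longrightarrow> f z = z * (h z + w z)"
    "h 0 = of_real (Re (c 1))"
    "\<And>z. cmod z < 1 \<Longrightarrow>
       ((\<lambda>k. (c k + cnj (c (2 - k))) * z powi k) has_sum (z * h z - of_real (Re (c 1)) * z)) {1<..}"
proof -
  \<comment> \<open>The Laurent coefficients of \<open>w\<close>. The negative ones are those of f /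
    z; the positive ones are forced by V (- j) = - cnj (V j), which makes \<open>w\<close> purely
    imaginary on the unit circle. The same symmetry forces V 0 to be imaginary, so Im (c 1) goes
    into \<open>w\<close> and Re (c 1) stays in \<open>h\<close>. For i > 0 the remainder
    \<open>e i\<close> is c (1 + i) + cnj (c (1 - i)), the coefficient of the claimed formula at k =
    1 + i.\<close>
  define V where "V j = (if j < 0 then c (1 + j) else if j = 0 then \<i> * of_real (Im (c 1)) else - cnj (c (1 - j)))" for j
  have V_minus: "cnj (V j) = - V (- j)" for j by (auto simp: V_def)
  \<comment> \<open>A symmetric range covering all nonzero \<open>V j\<close>; symmetry is used when
    the sum is conjugated and reindexed.\<close>
  define M where "M = \<bar>m\<bar> + 1"
  have V0: "V j = 0" if "j \<notin> {- M..M}" for j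
    using that by (auto simp: V_def M_def intro!: c0)
  define w where "w z = (\<Sum>j\<in>{- M..M}. V j * z powi j)" for z
  define e where "e i = c (1 + int i) - V (int i)" for i
  have e: "((\<lambda>i. e i * z ^ i) has_sum (f z / z - w z)) UNIV" if z: "0 < cmod z" "cmod z < 1" for z
  proof -
    have "((\<lambda>k. c k * z powi k) has_sum f z) UNIV"
      using sum[OF z] by (rule has_sum_cong_neutral[THEN iffD1, rotated 3]) (auto simp: c0)
    from has_sum_cmult_left[OF this, of "inverse z"]
    have "((\<lambda>k. c k * z powi k * inverse z) has_sum (f z / z)) UNIV" by (simp add: divide_inverse)
    also have "?this \<longleftrightarrow> ((\<lambda>j. c (1 + j) * z powi j) has_sum (f z / z)) UNIV"
      by (rule has_sum_reindex_bij_witness[of _ "\<lambda>j. 1 + j" "\<lambda>k. k - 1"])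
         (use z in \<open>auto simp: power_int_diff divide_inverse\<close>)
    moreover have "((\<lambda>j. - (V j * z powi j)) has_sum (- w z)) UNIV"
      unfolding has_sum_uminus by (rule has_sum_finite_neutralI[of "{- M..M}"]) (auto simp: w_def V0)
    ultimately have "((\<lambda>j. c (1 + j) * z powi j + - (V j * z powi j)) has_sum (f z / z + - w z)) UNIV"
      by (intro has_sum_add) auto
    then have "((\<lambda>j. c (1 + j) * z powi j - V j * z powi j) has_sum (f z / z - w z)) UNIV"
      by simp
    also have "?this \<longleftrightarrow> ((\<lambda>j. c (1 + j) * z powi j - V j * z powi j) has_sum (f z / z - w z)) {0..}"
      by (rule has_sum_cong_neutral) (auto simp: V_def)
    also have "\<dots> \<longleftrightarrow> ((\<lambda>i. e i * z ^ i) has_sum (f z / z - w z)) UNIV"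
      by (rule has_sum_reindex_bij_witness[of _ int nat]) (auto simp: e_def power_int_def algebra_simps)
    finally show ?thesis .
  qed
  define h where "h z = (\<Sum>i. e i * z ^ i)" for z
  have hsum: "((\<lambda>i. e i * z ^ i) has_sum h z) UNIV" if "cmod z < 1" for z
  proof (cases "z = 0")
    case True
    have "h 0 = e 0" unfolding h_def by (rule powser_zero)
    then show ?thesis
      unfolding True by (intro has_sum_finite_neutralI[of "{0}"]) (auto simp: power_0_left)
  next
    case False
    then show ?thesis
      using e[of z] that by (simp add: h_def has_sum_imp_sums[THEN sums_unique, symmetric])
  qed
  show thesis
  proof (rule that)
    show "h holomorphic_on ball 0 1"
      by (rule power_series_holomorphic[of _ _ e]) (use hsum in \<open>auto intro: has_sum_imp_sums\<close>)
    show "w holomorphic_on - {0}" unfolding w_def by (auto intro!: holomorphic_intros)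
    show "f z = z * (h z + w z)" if "0 < cmod z" "cmod z < 1" for z
      using has_sum_unique[OF e[OF that] hsum[OF that(2)]] that by (auto simp: field_simps)
    show "h 0 = of_real (Re (c 1))"
    proof -
      have "h 0 = e 0" unfolding h_def by (rule powser_zero)
      then show ?thesis by (simp add: e_def V_def complex_eq_iff)
    qed
    show "Re (w z) = 0" if z: "cmod z = 1" for z
    proof -
      have "cnj z = inverse z" using z inverse_unique[of z "cnj z"] complex_norm_square[of z] by simp
      then have "cnj (w z) = (\<Sum>j\<in>{- M..M}. - (V (- j) * z powi (- j)))"
        unfolding w_def by (simp add: V_minus power_int_minus power_int_inverse)
      also have "\<dots> = (\<Sum>j\<in>{- M..M}. - (V j * z powi j))"
        by (rule sum.reindex_bij_witness[of _ uminus uminus]) auto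
      also have "\<dots> = - w z" by (simp add: w_def sum_negf)
      finally show ?thesis by (simp add: complex_eq_iff)
    qed
    show "((\<lambda>k. (c k + cnj (c (2 - k))) * z powi k) has_sum (z * h z - of_real (Re (c 1)) * z)) {1<..}"
      if z: "cmod z < 1" for z
    proof -
      have "((\<lambda>i. z * (e i * z ^ i)) has_sum (z * h z)) UNIV"
        by (rule has_sum_cmult_right[OF hsum[OF z]])
      moreover have "((\<lambda>i. z * (e i * z ^ i)) has_sum (z * e 0)) {0}"
        by (rule has_sum_finiteI) auto
      ultimately have "((\<lambda>i. z * (e i * z ^ i)) has_sum (z * h z - z * e 0)) (UNIV - {0})"
        by (intro has_sum_Diff) auto
      also have "z * e 0 = of_real (Re (c 1)) * z"
        by (simp add: e_def V_def complex_eq_iff)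
      also have "((\<lambda>i. z * (e i * z ^ i)) has_sum (z * h z - of_real (Re (c 1)) * z)) (UNIV - {0}) \<longleftrightarrow>
        ((\<lambda>k. (c k + cnj (c (2 - k))) * z powi k) has_sum (z * h z - of_real (Re (c 1)) * z)) {1<..}"
      proof (rule has_sum_reindex_bij_witness[of _ "\<lambda>k. nat (k - 1)" "\<lambda>i. 1 + int i"])
        fix i :: nat assume i: "i \<in> UNIV - {0}"
        have "z powi (1 + int i) = z * z ^ i"
          by (cases "z = 0") (simp_all add: power_int_add power_int_0_left_if)
        then show "(c (1 + int i) + cnj (c (2 - (1 + int i)))) * z powi (1 + int i) = z * (e i * z ^ i)"
          using i by (simp add: e_def V_def algebra_simps)
      qed auto
      finally show ?thesis .
    qed
  qed
qed

section \<open>The flow of a power field\<close>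

text \<open>
  For \<open>n \<noteq> 0\<close>, solutions of \<open>z' = z ^ (n + 1)\<close> satisfy \<open>z(t) powi (- n) = z(0) powi (- n) - n t\<close>.
  Complex times are allowed so that estimates in \<open>t\<close> can use the Schwarz lemma.
\<close>
definition power_flow :: "int \<Rightarrow> complex \<Rightarrow> complex \<Rightarrow> complex" where
  "power_flow n t z = (if n = 0 then z * exp t
     else z * exp (- Ln (1 - of_int n * t * z powi n) / of_int n))"

text \<open>For n \<noteq> 0 the condition puts 1 - n t z^n into the right half plane, where the
  principal logarithm is holomorphic. It persists when |t| decreases, so it also covers all
  intermediate times of an integral curve.\<close>

definition flow_domain :: "int \<Rightarrow> (complex \<times> complex) set" where
  "flow_domain n = {(t, z). z \<noteq> 0 \<and> cmod (of_int n * t * z powi n) < 1}"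

lemma one_minus_notin_nonpos_Reals: "cmod a < 1 \<Longrightarrow> 1 - a \<notin> \<real>\<^sub>\<le>\<^sub>0"
  using complex_Re_le_cmod[of a] by (auto simp: complex_nonpos_Reals_iff)

lemma power_flow_0 [simp]: "power_flow n 0 z = z"
  by (simp add: power_flow_def)

lemma power_flow_eq_0_iff [simp]: "power_flow n t z = 0 \<longleftrightarrow> z = 0"
  by (simp add: power_flow_def)

lemma power_flow_powi:
  assumes "(t, z) \<in> flow_domain n" "n \<noteq> 0"
  shows "power_flow n t z powi n = z powi n / (1 - of_int n * t * z powi n)"
proof -
  have ne: "1 - of_int n * t * z powi n \<noteq> 0"
    using assms by (auto simp: flow_domain_def)
  have "power_flow n t z powi n = z powi n * exp (of_int n * (- Ln (1 - of_int n * t * z powi n) / of_int n))"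
    using assms by (simp add: power_flow_def power_int_mult_distrib exp_power_int)
  also have "of_int n * (- Ln (1 - of_int n * t * z powi n) / of_int n) = - Ln (1 - of_int n * t * z powi n)"
    using assms by simp
  also have "z powi n * exp \<dots> = z powi n / (1 - of_int n * t * z powi n)"
    using ne by (simp add: exp_minus exp_Ln divide_inverse)
  finally show ?thesis .
qed

text \<open>The image determines z^n through the conserved quantity. The exponential factor depends
  on z only through z^n, so it can be cancelled, which leaves no ambiguity by a root of
  unity.\<close>

lemma inj_on_power_flow: "inj_on (power_flow n t) {z. (t, z) \<in> flow_domain n}"
proof (rule inj_onI)
  fix z z' assume z: "z \<in> {z. (t, z) \<in> flow_domain n}" "z' \<in> {z. (t, z) \<in> flow_domain n}"
    and eq: "power_flow n t z = power_flow n t z'"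
  show "z = z'"
  proof (cases "n = 0")
    case False
    have "z powi n / (1 - of_int n * t * z powi n) = z' powi n / (1 - of_int n * t * z' powi n)"
      using power_flow_powi[of t z n] power_flow_powi[of t z' n] z eq False by simp
    moreover have "1 - of_int n * t * z powi n \<noteq> 0" "1 - of_int n * t * z' powi n \<noteq> 0"
      using z by (auto simp: flow_domain_def)
    ultimately have "z powi n = z' powi n" by (simp add: field_simps)
    then show ?thesis using eq False by (simp add: power_flow_def)
  qed (use eq in \<open>simp add: power_flow_def\<close>)
qed

lemma holomorphic_on_power_flow [holomorphic_intros]:
  assumes "f holomorphic_on A" "g holomorphic_on A" "\<And>x. x \<in> A \<Longrightarrow> (f x, g x) \<in> flow_domain n"
  shows "(\<lambda>x. power_flow n (f x) (g x)) holomorphic_on A"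
proof (cases "n = 0")
  case False
  have "g x \<noteq> 0" "1 - of_int n * f x * g x powi n \<notin> \<real>\<^sub>\<le>\<^sub>0" if "x \<in> A" for x
    using assms(3)[OF that] one_minus_notin_nonpos_Reals by (auto simp: flow_domain_def)
  then show ?thesis
    unfolding power_flow_def using False by (auto intro!: holomorphic_intros assms)
qed (auto simp: power_flow_def intro!: holomorphic_intros assms)

lemma continuous_on_power_flow [continuous_intros]:
  assumes "continuous_on A f" "continuous_on A g" "\<And>x. x \<in> A \<Longrightarrow> (f x, g x) \<in> flow_domain n"
  shows "continuous_on A (\<lambda>x. power_flow n (f x) (g x))"
proof (cases "n = 0")
  case False
  have "g x \<noteq> 0" "1 - of_int n * f x * g x powi n \<notin> \<real>\<^sub>\<le>\<^sub>0" if "x \<in> A" for x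
    using assms(3)[OF that] one_minus_notin_nonpos_Reals by (auto simp: flow_domain_def)
  then show ?thesis
    unfolding power_flow_def using False by (auto intro!: continuous_intros assms)
qed (auto simp: power_flow_def intro!: continuous_intros assms)

lemma DERIV_power_flow_time:
  assumes "(t, z) \<in> flow_domain n"
  shows "((\<lambda>t. power_flow n t z) has_field_derivative power_flow n t z powi (n + 1)) (at t)"
proof (cases "n = 0")
  case False
  have ne: "1 - of_int n * t * z powi n \<notin> \<real>\<^sub>\<le>\<^sub>0"
    using assms one_minus_notin_nonpos_Reals by (auto simp: flow_domain_def)
  have nz: "power_flow n t z \<noteq> 0" using assms by (auto simp: flow_domain_def)
  have "((\<lambda>t. z * exp (- Ln (1 - of_int n * t * z powi n) / of_int n)) has_field_derivative
          z * exp (- Ln (1 - of_int n * t * z powi n) / of_int n) * (z powi n / (1 - of_int n * t * z powi n))) (at t)"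
  proof -
    have "((\<lambda>t. - Ln (1 - of_int n * t * z powi n) / of_int n) has_field_derivative
            z powi n / (1 - of_int n * t * z powi n)) (at t)"
      using ne False by (auto intro!: derivative_eq_intros simp: divide_inverse)
    from DERIV_cmult[OF DERIV_chain2[OF DERIV_exp this], of z] show ?thesis
      by (simp add: mult.assoc)
  qed
  then show ?thesis
    using False nz power_flow_powi[OF assms False] by (simp add: power_flow_def power_int_add mult.commute)
qed (auto simp: power_flow_def intro!: derivative_eq_intros)

lemma flow_domain_compact:
  assumes "compact K" "0 \<notin> K"
  shows "\<exists>\<tau>>0. \<forall>z\<in>K. \<forall>t\<in>cball 0 \<tau>. (t, z) \<in> flow_domain n"
proof -
  have "continuous_on K (\<lambda>z. of_int n * z powi n :: complex)"
    using assms by (auto intro!: continuous_intros)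
  then have "bounded ((\<lambda>z. of_int n * z powi n :: complex) ` K)"
    using assms by (intro compact_imp_bounded compact_continuous_image)
  then obtain M where M: "M > 0" "\<And>z. z \<in> K \<Longrightarrow> cmod (of_int n * z powi n) < M"
    unfolding bounded_pos_less by fast
  have "(t, z) \<in> flow_domain n" if z: "z \<in> K" and t: "t \<in> cball 0 (1 / M)" for z t
  proof -
    have "cmod (of_int n * t * z powi n) = cmod t * cmod (of_int n * z powi n)"
      by (simp add: norm_mult)
    also have "\<dots> < 1"
    proof (cases "t = 0")
      case False
      have "cmod t * cmod (of_int n * z powi n) < cmod t * M"
        using M(2)[OF z] False by (intro mult_strict_left_mono) auto
      also have "\<dots> \<le> 1" using t M by (simp add: field_simps)
      finally show ?thesis .
    qed simp
    finally show ?thesis using assms z by (auto simp: flow_domain_def)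
  qed
  then show ?thesis using M by (intro exI[of _ "1 / M"]) auto
qed

text \<open>\<open>u powi (- n) - n s\<close> is a conserved quantity of the vector field \<open>L_field n\<close>.\<close>
lemma L_field_solution_unique:
  fixes u v :: "real \<Rightarrow> complex"
  assumes S: "convex S" "0 \<in> S" "s \<in> S" and eq0: "u 0 = v 0"
    and nz: "\<And>s. s \<in> S \<Longrightarrow> u s \<noteq> 0" "\<And>s. s \<in> S \<Longrightarrow> v s \<noteq> 0"
    and du: "\<And>s. s \<in> S \<Longrightarrow> (u has_vector_derivative L_field n (u s)) (at s within S)"
    and dv: "\<And>s. s \<in> S \<Longrightarrow> (v has_vector_derivative L_field n (v s)) (at s within S)"
  shows "u s = v s"
proof -
  have conserved: "w s powi (- n) - of_int n * of_real s = w 0 powi (- n)"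
    if nz: "\<And>s. s \<in> S \<Longrightarrow> w s \<noteq> 0" and s: "s \<in> S"
    and dw: "\<And>s. s \<in> S \<Longrightarrow> (w has_vector_derivative L_field n (w s)) (at s within S)" for w :: "real \<Rightarrow> complex" and s
  proof -
    have "\<exists>c. \<forall>s\<in>S. w s powi (- n) - of_int n * of_real s = c"
    proof (rule has_vector_derivative_zero_constant[OF S(1)])
      fix s assume s: "s \<in> S"
      have "((\<lambda>z. z powi (- n)) has_field_derivative of_int (- n) * w s powi (- n - 1)) (at (w s) within w ` S)"
        using nz[OF s] by (auto intro!: derivative_eq_intros)
      from field_vector_diff_chain_within[OF dw[OF s] this]
      have "((\<lambda>s. w s powi (- n)) has_vector_derivative L_field n (w s) * (of_int (- n) * w s powi (- n - 1))) (at s within S)"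
        by (simp add: o_def)
      also have "L_field n (w s) * (of_int (- n) * w s powi (- n - 1)) = of_int n * (w s powi (n + 1) * w s powi (- n - 1))"
        by (simp add: L_field_def)
      also have "w s powi (n + 1) * w s powi (- n - 1) = 1"
        using nz[OF s] by (subst power_int_add[symmetric]) auto
      finally show "((\<lambda>s. w s powi (- n) - of_int n * of_real s) has_vector_derivative 0) (at s within S)"
        by (auto intro!: derivative_eq_intros)
    qed blast
    then show ?thesis using S(2) s by (metis (no_types, opaque_lifting) diff_zero mult_zero_right of_real_0)
  qed
  have pw: "u s powi n = v s powi n" if s: "s \<in> S" for s
  proof -
    have "u s powi (- n) = v s powi (- n)"
      using conserved[OF nz(1) s du] conserved[OF nz(2) s dv] eq0 by (simp add: algebra_simps)
    then show ?thesis by (simp add: power_int_minus)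
  qed
  \<comment> \<open>Equal n-th powers leave a root of unity undetermined. They do make the
    derivative of u / v vanish, and the common initial value fixes the quotient.\<close>
  have "\<exists>c. \<forall>s\<in>S. u s / v s = c"
  proof (rule has_vector_derivative_zero_constant[OF S(1)])
    fix s assume s: "s \<in> S"
    have "((\<lambda>z. inverse z) has_field_derivative - inverse (v s ^ 2)) (at (v s) within v ` S)"
      using nz(2)[OF s] by (auto intro!: derivative_eq_intros simp: power2_eq_square)
    from field_vector_diff_chain_within[OF dv[OF s] this]
    have "((\<lambda>s. inverse (v s)) has_vector_derivative L_field n (v s) * - inverse (v s ^ 2)) (at s within S)"
      by (simp add: o_def)
    from has_vector_derivative_mult[OF du[OF s] this]
    have "((\<lambda>s. u s / v s) has_vector_derivative
             u s * (L_field n (v s) * - inverse (v s ^ 2)) + L_field n (u s) * inverse (v s)) (at s within S)"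
      by (simp add: divide_inverse)
    also have "u s * (L_field n (v s) * - inverse (v s ^ 2)) + L_field n (u s) * inverse (v s) = 0"
      using nz[OF s] pw[OF s] by (simp add: L_field_def power_int_add field_simps power2_eq_square)
    finally show "((\<lambda>s. u s / v s) has_vector_derivative 0) (at s within S)" .
  qed blast
  then have "u s / v s = u 0 / v 0" using S by metis
  then show ?thesis using eq0 nz S by simp
qed

text \<open>The sign in \<open>L_field\<close> and the negative time cancel, so this is the flow of
  z^(n + 1) for time t. As \<open>flow_image\<close> admits every solution curve, one inclusion
  rests on uniqueness of solutions.\<close>

lemma exp_L_eq_power_flow_image:
  assumes dom: "\<And>x. x \<in> \<gamma> \<Longrightarrow> (of_real t, x) \<in> flow_domain n"
  shows "exp_L n (- t) \<gamma> = power_flow n (of_real t) ` \<gamma>"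
proof -
  define I where "I = closed_segment 0 (- t)"
  have I: "convex I" "0 \<in> I" "- t \<in> I" by (auto simp: I_def)
  define w where "w x s = power_flow n (of_real (- s)) x" for x :: complex and s :: real
  have w: "w x 0 = x" "w x (- t) = power_flow n (of_real t) x" for x
    by (simp_all add: w_def)
  have dw: "w x s \<noteq> 0 \<and> (w x has_vector_derivative L_field n (w x s)) (at s within I)"
    if x: "x \<in> \<gamma>" and s: "s \<in> I" for x s
  proof -
    have "\<bar>s\<bar> \<le> \<bar>t\<bar>" using s by (auto simp: I_def closed_segment_eq_real_ivl split: if_splits)
    then have "cmod (of_int n * of_real (- s) * x powi n) \<le> cmod (of_int n * of_real t * x powi n)"
      unfolding norm_mult by (intro mult_right_mono mult_left_mono) auto
    then have D: "(of_real (- s), x) \<in> flow_domain n"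
      using dom[OF x] by (auto simp: flow_domain_def)
    have "((\<lambda>s. of_real (- s)) has_vector_derivative (- 1 :: complex)) (at s within I)"
      by (auto intro!: derivative_eq_intros)
    from field_vector_diff_chain_within[OF this has_field_derivative_at_within[OF DERIV_power_flow_time[OF D]]]
    show ?thesis using D by (auto simp: w_def[abs_def] o_def L_field_def flow_domain_def)
  qed
  show ?thesis
  proof (rule set_eqI, rule iffI)
    fix y assume "y \<in> exp_L n (- t) \<gamma>"
    then obtain x u where x: "x \<in> \<gamma>" and u: "u 0 = x" "u (- t) = y"
      and du: "\<And>s. s \<in> I \<Longrightarrow> u s \<noteq> 0 \<and> (u has_vector_derivative L_field n (u s)) (at s within I)"
      unfolding exp_L_def flow_image_def I_def by auto
    have "u (- t) = w x (- t)"
      by (rule L_field_solution_unique[OF I]) (use u du dw[OF x] w in auto)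
    then show "y \<in> power_flow n (of_real t) ` \<gamma>" using x u w by auto
  next
    fix y assume "y \<in> power_flow n (of_real t) ` \<gamma>"
    then obtain x where x: "x \<in> \<gamma>" "y = w x (- t)" using w by auto
    show "y \<in> exp_L n (- t) \<gamma>"
      unfolding exp_L_def flow_image_def mem_Collect_eq I_def[symmetric]
      by (rule bexI[OF _ x(1)], rule exI[of _ "w x"]) (use x dw w in auto)
  qed
qed

text \<open>At time 0 the flow is the identity in its starting point, so the velocity of a moving
  starting point and the field simply add.\<close>

lemma DERIV_power_flow_at_0:
  assumes "(g has_field_derivative g') (at 0)" "g 0 \<noteq> 0"
  shows "((\<lambda>t. power_flow n t (g t)) has_field_derivative g' + g 0 powi (n + 1)) (at 0)"
proof (cases "n = 0")
  case False
  have "((\<lambda>t. g t * exp (- Ln (1 - of_int n * t * g t powi n) / of_int n)) has_field_derivative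
          g' + g 0 powi (n + 1)) (at 0)"
    using assms False
    by (auto intro!: derivative_eq_intros simp: power_int_add)
  then show ?thesis using False by (simp add: power_flow_def)
next
  case True
  have "((\<lambda>t. g t * exp t) has_field_derivative g' + g 0) (at 0)"
    using assms by (auto intro!: derivative_eq_intros)
  then show ?thesis using True by (simp add: power_flow_def)
qed

lemma power_flow_near_identity:
  assumes K: "compact K" "0 \<notin> K" and \<epsilon>: "\<epsilon> > 0"
  shows "\<exists>\<tau>>0. \<forall>z\<in>K. \<forall>t\<in>cball 0 \<tau>. (t, z) \<in> flow_domain n \<and> cmod (power_flow n t z - z) < \<epsilon>"
proof -
  obtain \<tau> where \<tau>: "\<tau> > 0" "\<And>z t. z \<in> K \<Longrightarrow> t \<in> cball 0 \<tau> \<Longrightarrow> (t, z) \<in> flow_domain n"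
    using flow_domain_compact[OF K] by metis
  have "uniformly_continuous_on (cball 0 \<tau> \<times> K) (\<lambda>x. power_flow n (fst x) (snd x))"
    by (intro compact_uniformly_continuous compact_Times continuous_intros)
       (use K \<tau> in auto)
  then obtain d where d: "d > 0"
    "\<And>x x'. x \<in> cball 0 \<tau> \<times> K \<Longrightarrow> x' \<in> cball 0 \<tau> \<times> K \<Longrightarrow> dist x' x < d \<Longrightarrow>
       dist (power_flow n (fst x') (snd x')) (power_flow n (fst x) (snd x)) < \<epsilon>"
    unfolding uniformly_continuous_on_def using \<epsilon> by metis
  have "(t, z) \<in> flow_domain n \<and> cmod (power_flow n t z - z) < \<epsilon>"
    if "z \<in> K" "t \<in> cball 0 (min \<tau> (d / 2))" for z t
  proof -
    have "dist (t, z) (0, z) < d" using that d(1) by (auto simp: dist_Pair_Pair)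
    then show ?thesis
      using d(2)[of "(0, z)" "(t, z)"] \<tau> that by (auto simp: dist_norm)
  qed
  then show ?thesis using \<tau> d by (intro exI[of _ "min \<tau> (d / 2)"]) auto
qed

section \<open>Riemann maps of Jordan interiors\<close>

text \<open>The conditions in \<open>phi_plus\<close> without extensionality, so values outside the
  disc do not matter and any candidate map can be tested.\<close>

definition normalized_riemann_map :: "complex set \<Rightarrow> (complex \<Rightarrow> complex) \<Rightarrow> bool" where
  "normalized_riemann_map U \<phi> \<longleftrightarrow> \<phi> holomorphic_on ball 0 1 \<and> bij_betw \<phi> (ball 0 1) U \<and>
     \<phi> 0 = 0 \<and> deriv \<phi> 0 \<in> \<real> \<and> 0 < Re (deriv \<phi> 0)"

lemma riemann_map_inverse:
  assumes "normalized_riemann_map U \<phi>"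
  obtains F where "F holomorphic_on U" "\<And>z. z \<in> ball 0 1 \<Longrightarrow> F (\<phi> z) = z"
    "\<And>w. w \<in> U \<Longrightarrow> cmod (F w) < 1 \<and> \<phi> (F w) = w"
    "deriv \<phi> 0 * deriv F 0 = 1"
proof -
  have hol: "\<phi> holomorphic_on ball 0 1" and inj: "inj_on \<phi> (ball 0 1)" and im: "\<phi> ` ball 0 1 = U"
    and 0: "\<phi> 0 = 0"
    using assms by (auto simp: normalized_riemann_map_def bij_betw_def)
  obtain F where F: "F holomorphic_on (\<phi> ` ball 0 1)"
      "\<And>z. z \<in> ball 0 1 \<Longrightarrow> deriv \<phi> z * deriv F (\<phi> z) = 1"
      "\<And>z. z \<in> ball 0 1 \<Longrightarrow> F (\<phi> z) = z"
    using holomorphic_has_inverse[OF hol open_ball inj] by metis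
  show thesis
  proof (rule that)
    show "cmod (F w) < 1 \<and> \<phi> (F w) = w" if "w \<in> U" for w
      using that F(3) unfolding im[symmetric] by auto
    show "deriv \<phi> 0 * deriv F 0 = 1" using F(2)[of 0] 0 by simp
  qed (use F im in auto)
qed

text \<open>With inverses F and G of the two maps, G \<circ> \<phi> and F \<circ> \<psi> are
  mutually inverse self-maps of the disc fixing 0. The Schwarz lemma in both directions makes them
  rotations, and positive derivatives at 0 leave only the identity.\<close>

lemma normalized_riemann_map_unique:
  assumes "normalized_riemann_map U \<phi>" "normalized_riemann_map U \<psi>" "z \<in> ball 0 1"
  shows "\<phi> z = \<psi> z"
proof -
  obtain G where G: "G holomorphic_on U" "\<And>z. z \<in> ball 0 1 \<Longrightarrow> G (\<psi> z) = z"
    "\<And>w. w \<in> U \<Longrightarrow> cmod (G w) < 1 \<and> \<psi> (G w) = w" "deriv \<psi> 0 * deriv G 0 = 1"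
    using riemann_map_inverse[OF assms(2)] by metis
  obtain F where F: "F holomorphic_on U" "\<And>z. z \<in> ball 0 1 \<Longrightarrow> F (\<phi> z) = z"
    "\<And>w. w \<in> U \<Longrightarrow> cmod (F w) < 1 \<and> \<phi> (F w) = w"
    using riemann_map_inverse[OF assms(1)] by metis
  have hol: "\<phi> holomorphic_on ball 0 1" "\<psi> holomorphic_on ball 0 1"
    and im: "\<phi> ` ball 0 1 = U" "\<psi> ` ball 0 1 = U"
    and 0: "\<phi> 0 = 0" "\<psi> 0 = 0" and inj: "inj_on \<phi> (ball 0 1)"
    and d: "deriv \<phi> 0 \<in> \<real>" "0 < Re (deriv \<phi> 0)" "deriv \<psi> 0 \<in> \<real>" "0 < Re (deriv \<psi> 0)"
    using assms by (auto simp: normalized_riemann_map_def bij_betw_def)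
  have "open (\<phi> ` ball 0 1)"
    by (rule open_mapping_thm3[OF hol(1) open_ball inj])
  then have oU: "open U" using im by simp
  define M where "M = G \<circ> \<phi>"
  have M0: "M 0 = 0" using G(2)[of 0] 0 by (simp add: M_def)
  have holM: "M holomorphic_on ball 0 1"
    unfolding M_def by (rule holomorphic_on_compose_gen[OF hol(1) G(1)]) (use im in auto)
  have holN: "(F \<circ> \<psi>) holomorphic_on ball 0 1"
    by (rule holomorphic_on_compose_gen[OF hol(2) F(1)]) (use im in auto)
  have U: "\<phi> z \<in> U" "\<psi> z \<in> U" if "cmod z < 1" for z using im that by auto
  have M1: "cmod (M z) < 1" if "cmod z < 1" for z
    using G(3) U that by (auto simp: M_def)
  have "cmod (M z) \<le> cmod z" if "cmod z < 1" for z
    using Schwarz_Lemma(1)[OF holM M0 M1 that] by simp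
  moreover have "cmod z \<le> cmod (M z)" if z: "cmod z < 1" for z
  proof -
    have "cmod ((F \<circ> \<psi>) (M z)) \<le> cmod (M z)"
      by (rule Schwarz_Lemma(1)[OF holN _ _ M1[OF z]]) (use F(2)[of 0] F(3) 0 U in auto)
    moreover have "(F \<circ> \<psi>) (M z) = z" using F(2)[of z] G(3) U z by (simp add: M_def)
    ultimately show ?thesis by simp
  qed
  ultimately have eq: "cmod (M z) = cmod z" if "cmod z < 1" for z
    using that by (meson order_antisym)
  have "\<exists>\<alpha>. (\<forall>z. cmod z < 1 \<longrightarrow> M z = \<alpha> * z) \<and> cmod \<alpha> = 1"
    by (rule Schwarz_Lemma(3)[OF holM M0 M1, of 0]) (use eq[of "1/2"] in \<open>auto intro!: exI[of _ "1/2"]\<close>)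
  then obtain \<alpha> where \<alpha>: "\<And>z. cmod z < 1 \<Longrightarrow> M z = \<alpha> * z" "cmod \<alpha> = 1" by blast
  have "deriv M 0 = deriv G (\<phi> 0) * deriv \<phi> 0"
    unfolding M_def
    by (rule deriv_chain)
       (use hol G(1) oU U[of 0] 0 in \<open>auto intro!: holomorphic_on_imp_differentiable_at\<close>)
  moreover have "deriv M 0 = \<alpha>"
  proof (rule DERIV_imp_deriv)
    have "((\<lambda>z. \<alpha> * z) has_field_derivative \<alpha>) (at 0)"
      by (auto intro!: derivative_eq_intros)
    then show "(M has_field_derivative \<alpha>) (at 0)"
      by (rule has_field_derivative_transform_within_open[of _ _ _ "ball 0 1"]) (use \<alpha> in auto)
  qed
  ultimately have "\<alpha> * deriv \<psi> 0 = deriv \<phi> 0" using G(4) 0 by (simp add: mult_ac)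
  moreover obtain p q where pq: "deriv \<phi> 0 = of_real p" "deriv \<psi> 0 = of_real q" "p > 0" "q > 0"
    using d by (auto elim!: Reals_cases)
  ultimately have "\<alpha> = of_real (p / q)" by (simp add: field_simps)
  moreover from this have "p / q = 1"
    using \<alpha>(2) pq by (simp only: norm_of_real) simp
  ultimately have "\<alpha> = 1" by simp
  then have "G (\<phi> z) = z" using \<alpha>(1)[of z] assms by (simp add: M_def)
  then show ?thesis using G(3)[of "\<phi> z"] U[of z] assms by auto
qed

lemma normalized_riemann_map_exists:
  assumes "open U" "simply_connected U" "0 \<in> U" "bounded U"
  obtains \<phi> where "normalized_riemann_map U \<phi>"
proof -
  have "U \<noteq> {}" "U \<noteq> UNIV" using assms by (auto simp: not_bounded_UNIV)
  then have "\<exists>f g. f holomorphic_on U \<and> g holomorphic_on ball 0 1 \<and>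
      (\<forall>z\<in>U. f z \<in> ball 0 1 \<and> g (f z) = z) \<and> (\<forall>z\<in>ball 0 1. g z \<in> U \<and> f (g z) = z)"
    using Riemann_mapping_theorem[of U] assms(1,2) by blast
  then obtain f g where fg: "f holomorphic_on U" "g holomorphic_on ball 0 1"
      "\<And>z. z \<in> U \<Longrightarrow> f z \<in> ball 0 1 \<and> g (f z) = z"
      "\<And>z. z \<in> ball 0 1 \<Longrightarrow> g z \<in> U \<and> f (g z) = z"
    by blast
  define a where "a = f 0"
  have a: "cmod a < 1" using fg(3)[of 0] assms by (auto simp: a_def)
  have "a \<in> ball 0 1" using a by simp
  then obtain p q where pq: "p a = 0" "p holomorphic_on ball 0 1" "p ` ball 0 1 \<subseteq> ball 0 1"
      "q holomorphic_on ball 0 1" "q ` ball 0 1 \<subseteq> ball 0 1"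
      "\<And>z. z \<in> ball 0 1 \<Longrightarrow> p (q z) = z" "\<And>z. z \<in> ball 0 1 \<Longrightarrow> q (p z) = z"
    by (rule ball_biholomorphism_exists) (rule that)
  have q0: "q 0 = a" using pq(7)[of a] pq(1) a by simp
  define h where "h = g \<circ> q"
  have holh: "h holomorphic_on ball 0 1"
    unfolding h_def by (rule holomorphic_on_compose_gen[OF pq(4) fg(2) pq(5)])
  have bij: "bij_betw h (ball 0 1) U"
    by (rule bij_betw_byWitness[of _ "p \<circ> f"]) (use fg(3,4) pq(3,5,6,7) in \<open>auto simp: h_def image_subset_iff\<close>)
  have h0: "h 0 = 0" using fg(3)[of 0] q0 assms by (simp add: h_def a_def)
  have d0: "deriv h 0 \<noteq> 0"
    using holomorphic_injective_imp_regular[OF holh open_ball bij_betw_imp_inj_on[OF bij]] by simp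
  \<comment> \<open>The conjugate phase of the derivative: precomposing with this rotation makes the
    derivative at 0 equal to its modulus.\<close>
  define \<omega> where "\<omega> = cnj (deriv h 0) / of_real (cmod (deriv h 0))"
  have \<omega>: "cmod \<omega> = 1" using d0 by (simp add: \<omega>_def norm_divide)
  define \<phi> where "\<phi> = h \<circ> (\<lambda>z. \<omega> * z)"
  have "normalized_riemann_map U \<phi>"
    unfolding normalized_riemann_map_def
  proof (intro conjI)
    show "\<phi> holomorphic_on ball 0 1"
      unfolding \<phi>_def
      by (rule holomorphic_on_compose_gen[OF _ holh]) (use \<omega> in \<open>auto intro!: holomorphic_intros simp: norm_mult\<close>)
    have "bij_betw (\<lambda>z. \<omega> * z) (ball 0 1) (ball 0 1)"
      by (rule bij_betw_byWitness[of _ "\<lambda>z. z / \<omega>"]) (use \<omega> in \<open>auto simp: norm_mult norm_divide\<close>)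
    then show "bij_betw \<phi> (ball 0 1) U" unfolding \<phi>_def by (rule bij_betw_trans[OF _ bij])
    show "\<phi> 0 = 0" using h0 by (simp add: \<phi>_def)
    have "deriv \<phi> 0 = deriv h (\<omega> * 0) * deriv (\<lambda>z. \<omega> * z) 0"
      unfolding \<phi>_def
      by (rule deriv_chain) (use holh in \<open>auto intro!: holomorphic_on_imp_differentiable_at derivative_intros\<close>)
    also have "\<dots> = deriv h 0 * \<omega>" by simp
    also have "\<dots> = of_real (cmod (deriv h 0))"
      using d0 by (simp add: \<omega>_def complex_norm_square[symmetric] power2_eq_square)
    finally have "deriv \<phi> 0 = of_real (cmod (deriv h 0))" .
    then show "deriv \<phi> 0 \<in> \<real>" "0 < Re (deriv \<phi> 0)" using d0 by auto
  qed
  then show thesis by (rule that)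
qed

section \<open>Topology of the loops and well-definedness of \<open>phi_plus\<close>\<close>

lemma Loop1_parametrization:
  assumes "\<gamma> \<in> Loop1"
  obtains c where "simple_path c" "pathfinish c = pathstart c" "path_image c = \<gamma>"
proof -
  obtain h k where hk: "homeomorphism (sphere (0::complex) 1) \<gamma> h k"
    using assms by (auto simp: Loop1_def homeomorphic_def dest: homeomorphism_symD)
  have "simple_path (h \<circ> circlepath 0 1)"
    by (rule simple_path_continuous_image)
       (use hk in \<open>auto simp: simple_path_circlepath homeomorphism_def intro: inj_on_inverseI\<close>)
  moreover have "path_image (h \<circ> circlepath 0 1) = \<gamma>"
    using hk by (auto simp: path_image_compose homeomorphism_def)
  moreover have "pathfinish (h \<circ> circlepath 0 1) = pathstart (h \<circ> circlepath 0 1)"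
    by (simp add: pathfinish_compose pathstart_compose)
  ultimately show thesis using that by blast
qed

lemma Loop1_inside:
  assumes "\<gamma> \<in> Loop1"
  shows "open (inside \<gamma>)" "connected (inside \<gamma>)" "bounded (inside \<gamma>)" "simply_connected (inside \<gamma>)"
    "0 \<in> inside \<gamma>" "frontier (inside \<gamma>) = \<gamma>"
proof -
  obtain c where c: "simple_path c" "pathfinish c = pathstart c" "path_image c = \<gamma>"
    using Loop1_parametrization[OF assms] .
  from Jordan_inside_outside[OF c(1,2)] c(3)
  show "open (inside \<gamma>)" "connected (inside \<gamma>)" "bounded (inside \<gamma>)" "frontier (inside \<gamma>) = \<gamma>"
    by auto
  show "simply_connected (inside \<gamma>)" using simply_connected_inside_simple_path[OF c(1)] c(3) by simp
  show "0 \<in> inside \<gamma>" using assms by (simp add: Loop1_def)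
qed

lemma phi_plus_normalized:
  assumes "\<gamma> \<in> Loop1"
  shows "normalized_riemann_map (inside \<gamma>) (phi_plus \<gamma>)"
proof -
  let ?P = "\<lambda>\<phi>. \<phi> \<in> extensional (ball 0 1) \<and>
     \<phi> holomorphic_on ball 0 1 \<and> bij_betw \<phi> (ball 0 1) (inside \<gamma>) \<and>
     \<phi> 0 = 0 \<and> deriv \<phi> 0 \<in> \<real> \<and> 0 < Re (deriv \<phi> 0)"
  obtain \<psi> where \<psi>: "normalized_riemann_map (inside \<gamma>) \<psi>"
    using normalized_riemann_map_exists Loop1_inside[OF assms] by metis
  have d: "deriv (restrict \<psi> (ball 0 1)) 0 = deriv \<psi> 0"
    by (rule deriv_cong_ev) (auto intro!: eventually_mono[OF eventually_nhds_ball[of 1 0]])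
  have "restrict \<psi> (ball 0 1) holomorphic_on ball 0 1"
    by (rule holomorphic_transform[of \<psi>]) (use \<psi> in \<open>auto simp: normalized_riemann_map_def\<close>)
  then have "?P (restrict \<psi> (ball 0 1))"
    using \<psi> unfolding normalized_riemann_map_def d
    by (simp add: bij_betw_restrict_eq)
  moreover have "\<phi> = \<phi>'" if "?P \<phi>" "?P \<phi>'" for \<phi> \<phi>'
    by (rule extensionalityI[of _ "ball 0 1"])
       (use that normalized_riemann_map_unique[of "inside \<gamma>" \<phi> \<phi>'] in \<open>auto simp: normalized_riemann_map_def\<close>)
  ultimately have "?P (THE \<phi>. ?P \<phi>)"
    by (intro theI[of ?P "restrict \<psi> (ball 0 1)"]) blast+
  then show ?thesis by (simp add: phi_plus_def normalized_riemann_map_def)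
qed

text \<open>
  Winding numbers show that \<open>0\<close> stays inside a Jordan curve under a perturbation smaller than its
  distance from the curve.
\<close>
lemma Loop1_perturb:
  assumes \<gamma>: "\<gamma> \<in> Loop1" and cont: "continuous_on \<gamma> f" and inj: "inj_on f \<gamma>"
    and near: "\<And>x. x \<in> \<gamma> \<Longrightarrow> cmod (f x - x) < cmod x"
  shows "f ` \<gamma> \<in> Loop1"
proof -
  obtain c where c: "simple_path c" "pathfinish c = pathstart c" "path_image c = \<gamma>"
    using Loop1_parametrization[OF \<gamma>] .
  have sp: "simple_path (f \<circ> c)"
    by (rule simple_path_continuous_image) (use c cont inj in auto)
  have loop: "pathfinish (f \<circ> c) = pathstart (f \<circ> c)"
    using c by (simp add: pathfinish_compose pathstart_compose)
  have im: "path_image (f \<circ> c) = f ` \<gamma>" using c by (simp add: path_image_compose)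
  have nz: "0 \<notin> f ` \<gamma>" using near by fastforce
  have "winding_number (f \<circ> c) 0 = winding_number c 0"
  proof (rule winding_number_nearby_loops_eq)
    show "cmod ((f \<circ> c) t - c t) < cmod (c t - 0)" if "t \<in> {0..1}" for t
      using near[of "c t"] that c by (auto simp: path_image_def)
  qed (use c sp loop in \<open>auto simp: simple_path_imp_path\<close>)
  moreover have "cmod (winding_number c 0) = 1"
    by (rule simple_closed_path_norm_winding_number_inside) (use c \<gamma> in \<open>auto simp: Loop1_def\<close>)
  ultimately have "0 \<notin> outside (f ` \<gamma>)"
    using winding_number_zero_in_outside[of "f \<circ> c" 0] sp loop im by (auto simp: simple_path_imp_path)
  then have "0 \<in> inside (f ` \<gamma>)" using nz by (simp add: inside_outside)
  moreover have "f ` \<gamma> homeomorphic sphere (0::complex) 1"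
    using homeomorphic_simple_path_image_circle[OF sp loop, of 1 0] im by simp
  moreover have "compact (f ` \<gamma>)" using \<gamma> cont by (auto simp: Loop1_def intro: compact_continuous_image)
  ultimately show ?thesis using nz by (auto simp: Loop1_def)
qed

section \<open>Variation of the Riemann map\<close>

lemma eventually_at_0_realI:
  assumes "\<tau> > 0" "\<And>t :: real. t \<noteq> 0 \<Longrightarrow> \<bar>t\<bar> < \<tau> \<Longrightarrow> P t"
  shows "eventually P (at 0)"
  unfolding eventually_at using assms by (intro exI[of _ \<tau>]) (auto simp: dist_real_def)

lemma has_vector_derivative_at_0_quadraticI:
  fixes g :: "real \<Rightarrow> 'a::real_normed_vector"
  assumes "\<forall>\<^sub>F t in at 0. norm (g t - (g 0 + t *\<^sub>R D)) \<le> C * t\<^sup>2"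
  shows "(g has_vector_derivative D) (at 0)"
  unfolding has_vector_derivative_def has_derivative_at
proof
  show "bounded_linear (\<lambda>t. t *\<^sub>R D)" by (rule bounded_linear_scaleR_left)
  have lim: "((\<lambda>t::real. C * \<bar>t\<bar>) \<longlongrightarrow> C * \<bar>0\<bar>) (at 0)" by (intro tendsto_intros)
  show "(\<lambda>t. norm (g (0 + t) - g 0 - t *\<^sub>R D) / norm t) \<midarrow>0\<rightarrow> 0"
  proof (rule tendsto_sandwich[OF _ _ tendsto_const])
    have "\<forall>\<^sub>F t::real in at 0. t \<noteq> 0" by (rule eventually_neq_at_within)
    then show "\<forall>\<^sub>F t in at 0. norm (g (0 + t) - g 0 - t *\<^sub>R D) / norm t \<le> C * \<bar>t\<bar>"
      using assms
    proof eventually_elim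
      case (elim t)
      then have "norm (g (0 + t) - g 0 - t *\<^sub>R D) \<le> C * \<bar>t\<bar> * norm t"
        by (simp add: diff_diff_eq power2_eq_square mult.assoc)
      then show ?case using elim(1) by (simp add: divide_le_eq)
    qed
  qed (use lim in auto)
qed

text \<open>
  By \<open>split\<close>, the pullback by \<open>\<phi>\<close> of the field \<open>z ^ (n + 1)\<close> is the sum of \<open>z * h z\<close>, holomorphic in the
  disc, and \<open>z * w z\<close>, tangential to the unit circle.
\<close>
locale loop_variation =
  fixes n :: int and \<gamma> :: "complex set" and \<phi> h w :: "complex \<Rightarrow> complex" and \<eta> :: real
  assumes \<gamma>: "\<gamma> \<in> Loop1"
    and riemann: "normalized_riemann_map (inside \<gamma>) \<phi>"
    and hol_h: "h holomorphic_on ball 0 1"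
    and hol_w: "w holomorphic_on - {0}"
    and tangential: "\<And>z. cmod z = 1 \<Longrightarrow> Re (w z) = 0"
    and split: "\<And>z. 0 < cmod z \<Longrightarrow> cmod z < 1 \<Longrightarrow> \<phi> z powi (n + 1) = deriv \<phi> z * (z * (h z + w z))"
    and h0: "h 0 = of_real \<eta>"
begin

lemma hol_phi: "\<phi> holomorphic_on ball 0 1"
  and inj_phi: "inj_on \<phi> (ball 0 1)"
  and image_phi: "\<phi> ` ball 0 1 = inside \<gamma>"
  and phi_0: "\<phi> 0 = 0"
  using riemann by (auto simp: normalized_riemann_map_def bij_betw_def)

lemma deriv_phi_nz: "z \<in> ball 0 1 \<Longrightarrow> deriv \<phi> z \<noteq> 0"
  using holomorphic_injective_imp_regular[OF hol_phi open_ball inj_phi] .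

lemma phi_nz: "0 < cmod z \<Longrightarrow> cmod z < 1 \<Longrightarrow> \<phi> z \<noteq> 0"
  using inj_onD[OF inj_phi, of z 0] phi_0 by auto

lemma DERIV_phi: "z \<in> ball 0 1 \<Longrightarrow> (\<phi> has_field_derivative deriv \<phi> z) (at z)"
  using hol_phi by (simp add: holomorphic_derivI)

definition \<kappa> :: "complex \<Rightarrow> complex" where "\<kappa> z = deriv \<phi> z * (z * h z)"

definition \<xi> :: "complex \<Rightarrow> complex \<Rightarrow> complex" where "\<xi> t z = \<phi> z + t * \<kappa> z"

lemma hol_kappa: "\<kappa> holomorphic_on ball 0 1"
  unfolding \<kappa>_def[abs_def] by (intro holomorphic_intros hol_h holomorphic_deriv[OF hol_phi]) auto

lemma cont_phi: "continuous_on (ball 0 1) \<phi>" and cont_kappa: "continuous_on (ball 0 1) \<kappa>"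
  and cont_w: "continuous_on (- {0}) w"
  using hol_phi hol_kappa hol_w by (auto intro: holomorphic_on_imp_continuous_on)

text \<open>Moves the circle \<open>|z| = \<rho>\<close> by the tangential field \<open>z * w z\<close>, to first order in \<open>t\<close>.\<close>
definition \<Psi> :: "complex \<Rightarrow> complex \<Rightarrow> complex" where "\<Psi> t z = z * exp (t * w z)"

lemma Psi_eq_0_iff [simp]: "\<Psi> t z = 0 \<longleftrightarrow> z = 0"
  by (simp add: \<Psi>_def)

lemma hol_Psi: "\<Psi> t holomorphic_on - {0}"
  unfolding \<Psi>_def[abs_def] by (intro holomorphic_intros hol_w)

lemma hol_Psi_time: "(\<lambda>t. \<Psi> t z) holomorphic_on A"
  unfolding \<Psi>_def by (intro holomorphic_intros)

lemma cont_Psi: "continuous_on (T \<times> - {0}) (\<lambda>x. \<Psi> (fst x) (snd x))"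
  unfolding \<Psi>_def by (intro continuous_intros continuous_on_compose2[OF cont_w]) auto

lemma Psi_displacement:
  assumes \<rho>: "0 < \<rho>" "\<rho> < 1" and \<epsilon>: "\<epsilon> > 0"
  obtains \<tau> where "\<tau> > 0" "\<And>z t. cmod z = \<rho> \<Longrightarrow> cmod t \<le> \<tau> \<Longrightarrow> \<rho> - \<epsilon> < cmod (\<Psi> t z) \<and> cmod (\<Psi> t z) < \<rho> + \<epsilon>"
proof -
  have "uniformly_continuous_on (cball 0 1 \<times> sphere 0 \<rho>) (\<lambda>x. \<Psi> (fst x) (snd x))"
    by (intro compact_uniformly_continuous compact_Times continuous_on_subset[OF cont_Psi])
       (use \<rho> in auto)
  then obtain d where d: "d > 0"
    "\<And>x x'. x \<in> cball 0 1 \<times> sphere 0 \<rho> \<Longrightarrow> x' \<in> cball 0 1 \<times> sphere 0 \<rho> \<Longrightarrow> dist x' x < d \<Longrightarrow>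
       dist (\<Psi> (fst x') (snd x')) (\<Psi> (fst x) (snd x)) < \<epsilon>"
    unfolding uniformly_continuous_on_def using \<epsilon> by metis
  show thesis
  proof (rule that)
    show "min 1 (d / 2) > 0" using d by simp
    fix z t :: complex assume z: "cmod z = \<rho>" and t: "cmod t \<le> min 1 (d / 2)"
    have "dist (t, z) (0, z) < d" using t d(1) by (auto simp: dist_Pair_Pair)
    then have "dist (\<Psi> t z) (\<Psi> 0 z) < \<epsilon>" using d(2)[of "(0, z)" "(t, z)"] z t by auto
    then have "cmod (\<Psi> t z - z) < \<epsilon>" by (simp add: dist_norm \<Psi>_def)
    then show "\<rho> - \<epsilon> < cmod (\<Psi> t z) \<and> cmod (\<Psi> t z) < \<rho> + \<epsilon>"
      using norm_triangle_ineq3[of "\<Psi> t z" z] z by linarith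
  qed
qed

section \<open>Second-order agreement of the flow, \<open>\<xi>\<close> and \<open>\<Psi>\<close> on
  circles\<close>

lemma DERIV_Psi_time: "((\<lambda>t. \<Psi> t z) has_field_derivative z * w z) (at 0)"
  unfolding \<Psi>_def by (auto intro!: derivative_eq_intros)

lemma Psi_0 [simp]: "\<Psi> 0 z = z" by (simp add: \<Psi>_def)

lemma DERIV_phi_Psi:
  assumes "z \<in> ball 0 1"
  shows "((\<lambda>t. \<phi> (\<Psi> t z)) has_field_derivative deriv \<phi> z * (z * w z)) (at 0)"
  using DERIV_chain2[OF _ DERIV_Psi_time, of \<phi> "deriv \<phi> z" z] DERIV_phi[OF assms] by simp

text \<open>Both sides start at \<phi> z, and \<open>split\<close> says exactly that their
  first-order terms agree. This is the passage from \<open>q\<close> at a point of a circle to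
  \<open>p\<close> at the displaced point.\<close>

lemma flow_vs_xi_Psi:
  assumes \<rho>: "0 < \<rho>" "\<rho> < 1"
  shows "\<exists>C>0. \<exists>\<tau>>0. \<forall>z\<in>sphere 0 \<rho>. \<forall>t\<in>ball 0 \<tau>.
     cmod (power_flow n t (\<phi> z) - \<xi> t (\<Psi> t z)) \<le> C * (cmod t)\<^sup>2"
proof -
  have sub: "sphere 0 \<rho> \<subseteq> ball (0::complex) 1" using \<rho> by auto
  obtain \<tau>1 where \<tau>1: "\<tau>1 > 0" "\<And>z t. cmod z = \<rho> \<Longrightarrow> cmod t \<le> \<tau>1 \<Longrightarrow> \<rho> - (1 - \<rho>) < cmod (\<Psi> t z) \<and> cmod (\<Psi> t z) < \<rho> + (1 - \<rho>)"
    using Psi_displacement[OF \<rho>, of "1 - \<rho>"] \<rho> by (metis diff_gt_0_iff_gt)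
  have "compact (\<phi> ` sphere 0 \<rho>)" "0 \<notin> \<phi> ` sphere 0 \<rho>"
    using phi_nz \<rho> by (auto intro!: compact_continuous_image continuous_on_subset[OF cont_phi sub])
  from flow_domain_compact[OF this, of n] obtain \<tau>2 where \<tau>2: "\<tau>2 > 0"
      "\<And>z t. cmod z = \<rho> \<Longrightarrow> cmod t \<le> \<tau>2 \<Longrightarrow> (t, \<phi> z) \<in> flow_domain n"
    by auto
  define \<tau> where "\<tau> = min \<tau>1 \<tau>2"
  define D where "D t z = power_flow n t (\<phi> z) - \<xi> t (\<Psi> t z)" for t z
  have dom: "(t, \<phi> z) \<in> flow_domain n" "cmod (\<Psi> t z) < 1" "cmod z < 1" "z \<noteq> 0" if "cmod z = \<rho>" "cmod t \<le> \<tau>" for t z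
    using \<tau>1(2)[of z t] \<tau>2(2)[of z t] that \<rho> by (auto simp: \<tau>_def)
  have "\<exists>C>0. \<forall>z\<in>sphere 0 \<rho>. \<forall>t\<in>ball 0 \<tau>. cmod (D t z) \<le> C * (cmod t)\<^sup>2"
  proof (rule uniform_quadratic_bound)
    show "\<tau> > 0" using \<tau>1 \<tau>2 by (simp add: \<tau>_def)
    show "continuous_on (cball 0 \<tau> \<times> sphere 0 \<rho>) (\<lambda>(t, z). D t z)"
      unfolding D_def \<xi>_def case_prod_unfold
      by (intro continuous_intros continuous_on_compose2[OF cont_phi] continuous_on_compose2[OF cont_kappa]
            continuous_on_subset[OF cont_Psi])
         (use dom \<rho> in auto)
    fix z :: complex assume "z \<in> sphere 0 \<rho>"
    then have z: "cmod z = \<rho>" by simp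
    have z1: "z \<in> ball 0 1" using z \<rho> by simp
    show "(\<lambda>t. D t z) holomorphic_on ball 0 \<tau>"
      unfolding D_def \<xi>_def
      by (intro holomorphic_intros holomorphic_on_compose_gen[OF hol_Psi_time hol_phi, unfolded o_def]
           holomorphic_on_compose_gen[OF hol_Psi_time hol_kappa, unfolded o_def])
         (use dom[OF z] in auto)
    show "D 0 z = 0" by (simp add: D_def \<xi>_def)
    have "((\<lambda>t. \<kappa> (\<Psi> t z)) has_field_derivative deriv \<kappa> z * (z * w z)) (at 0)"
      using DERIV_chain2[OF _ DERIV_Psi_time, of \<kappa> "deriv \<kappa> z" z] holomorphic_derivI[OF hol_kappa open_ball z1] by simp
    from DERIV_mult[OF DERIV_ident this]
    have "((\<lambda>t. t * \<kappa> (\<Psi> t z)) has_field_derivative \<kappa> z) (at 0)" by simp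
    from DERIV_diff[OF DERIV_power_flow_at_0[OF DERIV_const[of "\<phi> z"], of n] DERIV_add[OF DERIV_phi_Psi[OF z1] this]]
    have "((\<lambda>t. D t z) has_field_derivative \<phi> z powi (n + 1) - (deriv \<phi> z * (z * w z) + \<kappa> z)) (at 0)"
      using phi_nz[of z] z \<rho> by (simp add: D_def \<xi>_def)
    then show "((\<lambda>t. D t z) has_field_derivative 0) (at 0)"
      using split[of z] z \<rho> by (simp add: \<kappa>_def algebra_simps)
  qed simp
  then show ?thesis using \<tau>1 \<tau>2 unfolding D_def \<tau>_def by (metis min_less_iff_conj)
qed

text \<open>The opposite passage: \<open>p\<close> at a prescribed point of a circle is compared
  with \<open>q\<close> at a displaced point, so the displacement is undone before the flow is
  applied.\<close>

lemma flow_Psi_vs_xi: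
  assumes \<rho>: "0 < \<rho>" "\<rho> < 1"
  shows "\<exists>C>0. \<exists>\<tau>>0. \<forall>z\<in>sphere 0 \<rho>. \<forall>t\<in>ball 0 \<tau>.
     cmod (power_flow n t (\<phi> (\<Psi> (- t) z)) - \<xi> t z) \<le> C * (cmod t)\<^sup>2"
proof -
  \<comment> \<open>Keeps the displaced circle in a closed annulus inside the disc and away from 0,
    so that one time bound serves the flow at all displaced points.\<close>
  define \<epsilon> where "\<epsilon> = min (\<rho> / 2) ((1 - \<rho>) / 2)"
  have \<epsilon>: "\<epsilon> > 0" "\<rho> / 2 \<le> \<rho> - \<epsilon>" "\<rho> + \<epsilon> < 1" using \<rho> by (auto simp: \<epsilon>_def min_def field_simps)
  obtain \<tau>1 where \<tau>1: "\<tau>1 > 0" "\<And>z t. cmod z = \<rho> \<Longrightarrow> cmod t \<le> \<tau>1 \<Longrightarrow> \<rho> - \<epsilon> < cmod (\<Psi> t z) \<and> cmod (\<Psi> t z) < \<rho> + \<epsilon>"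
    using Psi_displacement[OF \<rho> \<epsilon>(1)] by metis
  define S :: "complex set" where "S = cball 0 (\<rho> + \<epsilon>) - ball 0 (\<rho> / 2)"
  have S: "compact S" "S \<subseteq> ball 0 1" "0 \<notin> S" using \<epsilon> \<rho> by (auto simp: S_def intro!: compact_diff)
  have "compact (\<phi> ` S)" by (rule compact_continuous_image[OF continuous_on_subset[OF cont_phi S(2)] S(1)])
  moreover have "0 \<notin> \<phi> ` S"
  proof
    assume "0 \<in> \<phi> ` S"
    then obtain z where "z \<in> S" "\<phi> z = 0" by auto
    moreover from this have "z \<noteq> 0" "cmod z < 1" using S by auto
    ultimately show False using phi_nz[of z] by simp
  qed
  ultimately obtain \<tau>2 where \<tau>2: "\<tau>2 > 0" "\<And>z t. z \<in> S \<Longrightarrow> cmod t \<le> \<tau>2 \<Longrightarrow> (t, \<phi> z) \<in> flow_domain n"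
    using flow_domain_compact[of "\<phi> ` S" n] by auto
  define \<tau> where "\<tau> = min \<tau>1 \<tau>2"
  define D where "D t z = power_flow n t (\<phi> (\<Psi> (- t) z)) - \<xi> t z" for t z
  have dom: "(t, \<phi> (\<Psi> (- t) z)) \<in> flow_domain n" "cmod (\<Psi> (- t) z) < 1" "cmod z < 1" "z \<noteq> 0"
    if "cmod z = \<rho>" "cmod t \<le> \<tau>" for t z
    using \<tau>1(2)[of z "- t"] \<tau>2(2)[of "\<Psi> (- t) z" t] that \<rho> \<epsilon> by (auto simp: \<tau>_def S_def)
  have contm: "continuous_on (T \<times> - {0}) (\<lambda>x. \<Psi> (- fst x) (snd x))" for T
    by (intro continuous_on_compose2[OF cont_Psi[of UNIV], of _ "\<lambda>x. (- fst x, snd x)", simplified] continuous_intros) auto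
  have holm: "(\<lambda>t. \<Psi> (- t) z) holomorphic_on A" for A z
    unfolding \<Psi>_def by (intro holomorphic_intros)
  have "\<exists>C>0. \<forall>z\<in>sphere 0 \<rho>. \<forall>t\<in>ball 0 \<tau>. cmod (D t z) \<le> C * (cmod t)\<^sup>2"
  proof (rule uniform_quadratic_bound)
    show "\<tau> > 0" using \<tau>1 \<tau>2 by (simp add: \<tau>_def)
    show "continuous_on (cball 0 \<tau> \<times> sphere 0 \<rho>) (\<lambda>(t, z). D t z)"
      unfolding D_def \<xi>_def case_prod_unfold
      by (intro continuous_intros continuous_on_compose2[OF cont_phi] continuous_on_compose2[OF cont_kappa]
            continuous_on_subset[OF contm])
         (use dom \<rho> in auto)
    fix z :: complex assume "z \<in> sphere 0 \<rho>"
    then have z: "cmod z = \<rho>" by simp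
    have z1: "z \<in> ball 0 1" using z \<rho> by simp
    show "(\<lambda>t. D t z) holomorphic_on ball 0 \<tau>"
      unfolding D_def \<xi>_def
      by (intro holomorphic_intros holomorphic_on_compose_gen[OF holm hol_phi, unfolded o_def])
         (use dom[OF z] in auto)
    show "D 0 z = 0" by (simp add: D_def \<xi>_def)
    have "((\<lambda>t. \<phi> (\<Psi> (- t) z)) has_field_derivative - (deriv \<phi> z * (z * w z))) (at 0)"
    proof -
      have "((\<lambda>t. \<phi> (\<Psi> t z)) has_field_derivative deriv \<phi> z * (z * w z)) (at (- 0))"
        using DERIV_phi_Psi[OF z1] by simp
      from DERIV_chain2[OF this DERIV_minus[OF DERIV_ident]] show ?thesis by simp
    qed
    from DERIV_power_flow_at_0[OF this, of n]
    have "((\<lambda>t. power_flow n t (\<phi> (\<Psi> (- t) z))) has_field_derivative - (deriv \<phi> z * (z * w z)) + \<phi> z powi (n + 1)) (at 0)"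
      using phi_nz[of z] z \<rho> by simp
    then have "((\<lambda>t. D t z) has_field_derivative - (deriv \<phi> z * (z * w z)) + \<phi> z powi (n + 1) - \<kappa> z) (at 0)"
      unfolding D_def \<xi>_def by (auto intro!: derivative_eq_intros)
    then show "((\<lambda>t. D t z) has_field_derivative 0) (at 0)"
      using split[of z] z \<rho> by (simp add: \<kappa>_def algebra_simps)
  qed simp
  then show ?thesis using \<tau>1 \<tau>2 unfolding D_def \<tau>_def by (metis min_less_iff_conj)
qed

text \<open>The exponential is the quotient \<Psi> t (\<Psi> (- t) z) / z. \<open>\<Psi>\<close> is
  not a flow, so opposite times need not cancel exactly, but they do so up to second order.\<close>

lemma Psi_Psi_quadratic:
  assumes \<rho>: "0 < \<rho>" "\<rho> < 1"
  shows "\<exists>C>0. \<exists>\<tau>>0. \<forall>z\<in>sphere 0 \<rho>. \<forall>t\<in>ball 0 \<tau>.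
     cmod (exp (t * (w (\<Psi> (- t) z) - w z)) - 1) \<le> C * (cmod t)\<^sup>2"
proof -
  define D where "D t z = exp (t * (w (\<Psi> (- t) z) - w z)) - 1" for t z
  have contm: "continuous_on (T \<times> - {0}) (\<lambda>x. \<Psi> (- fst x) (snd x))" for T
    by (intro continuous_on_compose2[OF cont_Psi[of UNIV], of _ "\<lambda>x. (- fst x, snd x)", simplified] continuous_intros) auto
  have holm: "(\<lambda>t. w (\<Psi> (- t) z)) holomorphic_on A" if "z \<noteq> 0" for A z
    by (rule holomorphic_on_compose_gen[OF _ hol_w, unfolded o_def])
       (use that in \<open>auto simp: \<Psi>_def intro!: holomorphic_intros\<close>)
  have "\<exists>C>0. \<forall>z\<in>sphere 0 \<rho>. \<forall>t\<in>ball 0 1. cmod (D t z) \<le> C * (cmod t)\<^sup>2"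
  proof (rule uniform_quadratic_bound)
    show "continuous_on (cball 0 1 \<times> sphere 0 \<rho>) (\<lambda>(t, z). D t z)"
      unfolding D_def case_prod_unfold
      by (intro continuous_intros continuous_on_compose2[OF cont_w] continuous_on_subset[OF contm])
         (use \<rho> in auto)
    fix z :: complex assume "z \<in> sphere 0 \<rho>"
    then have z: "z \<noteq> 0" using \<rho> by auto
    show "(\<lambda>t. D t z) holomorphic_on ball 0 1"
      unfolding D_def by (intro holomorphic_intros holm z)
    show "D 0 z = 0" by (simp add: D_def)
    have "((\<lambda>t. w (\<Psi> (- t) z)) has_field_derivative deriv (\<lambda>t. w (\<Psi> (- t) z)) 0) (at 0)"
      by (rule holomorphic_derivI[OF holm[OF z] open_UNIV]) simp
    then show "((\<lambda>t. D t z) has_field_derivative 0) (at 0)"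
      unfolding D_def by (auto intro!: derivative_eq_intros)
  qed auto
  then show ?thesis unfolding D_def by (metis zero_less_one)
qed

section \<open>The perturbed loop and the Riemann map of its interior\<close>

abbreviation \<gamma>t :: "real \<Rightarrow> complex set" where "\<gamma>t t \<equiv> exp_L n (- t) \<gamma>"

text \<open>Connectedness locates the moved collar inside the moved curve. The last conclusion says
  that the flow carries points near the boundary out of every compact part of the perturbed
  interior, which is what replaces boundary regularity.\<close>

lemma perturbed_loop:
  assumes \<rho>: "0 < \<rho>0" "\<rho>0 < \<rho>5" "\<rho>5 < 1"
  obtains B \<tau> where "B > 0" "\<tau> > 0"
    "\<And>t. \<bar>t\<bar> \<le> \<tau> \<Longrightarrow> \<gamma>t t \<in> Loop1"
    "\<And>t. \<bar>t\<bar> \<le> \<tau> \<Longrightarrow> \<phi> ` cball 0 \<rho>5 \<subseteq> inside (\<gamma>t t)"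
    "\<And>t. \<bar>t\<bar> \<le> \<tau> \<Longrightarrow> inside (\<gamma>t t) \<subseteq> ball 0 B"
    "\<And>t z. \<bar>t\<bar> \<le> \<tau> \<Longrightarrow> \<rho>0 \<le> cmod z \<Longrightarrow> cmod z < 1 \<Longrightarrow> (of_real t, \<phi> z) \<in> flow_domain n"
    "\<And>t z. \<bar>t\<bar> \<le> \<tau> \<Longrightarrow> \<rho>0 \<le> cmod z \<Longrightarrow> cmod z < 1 \<Longrightarrow> power_flow n (of_real t) (\<phi> z) \<in> inside (\<gamma>t t)"
    "\<And>t C. \<bar>t\<bar> \<le> \<tau> \<Longrightarrow> compact C \<Longrightarrow> C \<subseteq> inside (\<gamma>t t) \<Longrightarrow>
       \<exists>\<delta><1. \<forall>z. \<delta> < cmod z \<and> cmod z < 1 \<longrightarrow> power_flow n (of_real t) (\<phi> z) \<notin> C"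
proof -
  note U = Loop1_inside[OF \<gamma>]
  have open_img: "open (\<phi> ` ball 0 r)" if "r \<le> 1" for r
    by (rule open_mapping_thm3)
       (use that in \<open>auto intro: holomorphic_on_subset[OF hol_phi] inj_on_subset[OF inj_phi]\<close>)
  have \<gamma>U: "\<gamma> \<inter> inside \<gamma> = {}" using inside_no_overlap[of \<gamma>] by blast
  have clU: "closure (inside \<gamma>) = inside \<gamma> \<union> \<gamma>" using closure_Un_frontier[of "inside \<gamma>"] U(6) by simp
  \<comment> \<open>A closed collar: it contains the curve and omits a neighbourhood of 0, so the
    flow is defined and close to the identity on it for small times.\<close>
  define A where "A = closure (inside \<gamma>) - \<phi> ` ball 0 \<rho>0"
  have cA: "compact A"
    unfolding A_def using U(3) open_img[of \<rho>0] \<rho> by (intro compact_diff) (auto simp: compact_closure)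
  have A0: "0 \<notin> A" using phi_0 \<rho> by (force simp: A_def)
  have A1: "\<gamma> \<subseteq> A"
  proof -
    have "\<phi> ` ball 0 \<rho>0 \<subseteq> inside \<gamma>" using image_phi \<rho> by (auto simp flip: image_phi)
    then show ?thesis using \<gamma>U by (auto simp: A_def clU)
  qed
  have A2: "\<phi> z \<in> A" if "\<rho>0 \<le> cmod z" "cmod z < 1" for z
  proof -
    have "\<phi> z \<notin> \<phi> ` ball 0 \<rho>0"
    proof
      assume "\<phi> z \<in> \<phi> ` ball 0 \<rho>0"
      then obtain z' where "z' \<in> ball 0 \<rho>0" "\<phi> z = \<phi> z'" by auto
      then show False using inj_onD[OF inj_phi, of z z'] that \<rho> by auto
    qed
    moreover have "\<phi> z \<in> inside \<gamma>" using that by (auto simp flip: image_phi)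
    ultimately show ?thesis by (simp add: A_def clU)
  qed
  define K where "K = \<phi> ` cball 0 \<rho>5"
  have contK: "continuous_on (cball 0 \<rho>5) \<phi>" by (rule continuous_on_subset[OF cont_phi]) (use \<rho> in auto)
  have cK: "compact K" unfolding K_def by (rule compact_continuous_image[OF contK]) simp
  have KU: "K \<subseteq> inside \<gamma>" using \<rho> by (auto simp: K_def simp flip: image_phi)
  have conK: "connected K" unfolding K_def by (rule connected_continuous_image[OF contK]) simp
  have K0: "0 \<in> K" using phi_0 \<rho> by (force simp: K_def)
  have "compact \<gamma>" using \<gamma> by (simp add: Loop1_def)
  obtain \<epsilon>1 where \<epsilon>1: "\<epsilon>1 > 0" "\<And>x y. x \<in> K \<Longrightarrow> y \<in> \<gamma> \<Longrightarrow> \<epsilon>1 \<le> dist x y"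
    using separate_compact_closed[OF cK compact_imp_closed[OF \<open>compact \<gamma>\<close>]] KU \<gamma>U by blast
  \<comment> \<open>An anchor on the inner edge of the collar. Its moved image stays in
    \<open>K\<close>, hence inside the moved curve, and the connected image of the collar follows
    it.\<close>
  define b where "b = \<phi> (of_real \<rho>0)"
  have "b \<in> \<phi> ` ball 0 \<rho>5" using \<rho> by (auto simp: b_def)
  then obtain \<epsilon>2 where \<epsilon>2: "\<epsilon>2 > 0" "ball b \<epsilon>2 \<subseteq> \<phi> ` ball 0 \<rho>5"
    using open_img[of \<rho>5] \<rho> by (meson less_imp_le open_contains_ball)
  have bK: "ball b \<epsilon>2 \<subseteq> K" using \<epsilon>2(2) by (auto simp: K_def)
  obtain R where R: "R > 0" "\<And>x. x \<in> \<gamma> \<Longrightarrow> cmod x < R"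
    using compact_imp_bounded[OF \<open>compact \<gamma>\<close>] by (auto simp: bounded_pos_less)
  \<comment> \<open>The moved curve stays off \<open>K\<close> by \<epsilon>1, the moved anchor
    stays in \<open>K\<close> by \<epsilon>2, and the moved curve stays in the ball of radius R + 1
    by the bound 1.\<close>
  define \<epsilon> where "\<epsilon> = min (min \<epsilon>1 \<epsilon>2) 1"
  obtain \<tau> where \<tau>: "\<tau> > 0"
    "\<And>z t. z \<in> A \<Longrightarrow> cmod t \<le> \<tau> \<Longrightarrow> (t, z) \<in> flow_domain n \<and> cmod (power_flow n t z - z) < \<epsilon>"
    using power_flow_near_identity[OF cA A0, of \<epsilon> n] \<epsilon>1 \<epsilon>2 by (auto simp: \<epsilon>_def)
  let ?f = "\<lambda>t::real. power_flow n (of_real t)"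
  have near: "cmod (?f t z - z) < \<epsilon>1" "cmod (?f t z - z) < \<epsilon>2" "cmod (?f t z - z) < 1"
      "(of_real t, z) \<in> flow_domain n" if "\<bar>t\<bar> \<le> \<tau>" "z \<in> A" for t z
    using \<tau>(2)[of z "of_real t"] that by (auto simp: \<epsilon>_def)
  have eq: "\<gamma>t t = ?f t ` \<gamma>" if "\<bar>t\<bar> \<le> \<tau>" for t
    by (rule exp_L_eq_power_flow_image) (use near[OF that] A1 in auto)
  have contA: "continuous_on A (?f t)" if "\<bar>t\<bar> \<le> \<tau>" for t
    by (intro continuous_intros) (use near[OF that] in auto)
  have injA: "inj_on (?f t) A" if "\<bar>t\<bar> \<le> \<tau>" for t
    by (rule inj_on_subset[OF inj_on_power_flow]) (use near[OF that] in auto)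
  have L: "\<gamma>t t \<in> Loop1" if t: "\<bar>t\<bar> \<le> \<tau>" for t
    unfolding eq[OF t]
  proof (rule Loop1_perturb[OF \<gamma> continuous_on_subset[OF contA[OF t] A1] inj_on_subset[OF injA[OF t] A1]])
    fix x assume x: "x \<in> \<gamma>"
    have "cmod (?f t x - x) < \<epsilon>1" using near(1)[OF t] x A1 by auto
    also have "\<dots> \<le> cmod x" using \<epsilon>1(2)[OF K0 x] by simp
    finally show "cmod (?f t x - x) < cmod x" .
  qed
  have inside_connected: "T \<subseteq> inside (\<gamma>t t)"
    if "connected T" "T \<inter> \<gamma>t t = {}" "T \<inter> inside (\<gamma>t t) \<noteq> {}" "\<bar>t\<bar> \<le> \<tau>" for T t
    using connected_Int_frontier[OF that(1,3)] that(2) Loop1_inside(6)[OF L[OF that(4)]] by auto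
  have Kt: "K \<subseteq> inside (\<gamma>t t)" if t: "\<bar>t\<bar> \<le> \<tau>" for t
  proof (rule inside_connected[OF conK _ _ t])
    show "K \<inter> \<gamma>t t = {}"
    proof (rule ccontr)
      assume "K \<inter> \<gamma>t t \<noteq> {}"
      then obtain x where x: "x \<in> \<gamma>" "?f t x \<in> K" unfolding eq[OF t] by auto
      then show False using \<epsilon>1(2)[OF x(2,1)] near(1)[OF t, of x] A1 by (auto simp: dist_norm)
    qed
    show "K \<inter> inside (\<gamma>t t) \<noteq> {}" using K0 Loop1_inside(5)[OF L[OF t]] by auto
  qed
  have ft: "?f t (\<phi> z) \<in> inside (\<gamma>t t)" if t: "\<bar>t\<bar> \<le> \<tau>" and z: "\<rho>0 \<le> cmod z" "cmod z < 1" for t z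
  proof -
    define T where "T = {z::complex. \<rho>0 \<le> cmod z \<and> cmod z < 1}"
    have "connected T"
      using connected_annulus(3)[where 'N = complex, of \<rho>0 0 1] by (simp add: T_def)
    have imT: "\<phi> ` T \<subseteq> A" using A2 by (auto simp: T_def)
    have "connected (?f t ` \<phi> ` T)"
      by (intro connected_continuous_image \<open>connected T\<close> continuous_on_subset[OF contA[OF t] imT]
           continuous_on_subset[OF cont_phi]) (auto simp: T_def)
    moreover have "?f t ` \<phi> ` T \<inter> \<gamma>t t = {}"
    proof -
      have "\<phi> ` T \<inter> \<gamma> = {}" using \<gamma>U image_phi by (auto simp: T_def)
      then show ?thesis unfolding eq[OF t] using injA[OF t] imT A1 by (simp add: inj_on_image_Int[symmetric])
    qed
    moreover have "?f t ` \<phi> ` T \<inter> inside (\<gamma>t t) \<noteq> {}"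
    proof -
      have T0: "of_real \<rho>0 \<in> T" using \<rho> by (simp add: T_def)
      then have "b \<in> A" using imT by (auto simp: b_def)
      then have "?f t b \<in> K" using near(2)[OF t] bK by (auto simp: subset_iff dist_norm norm_minus_commute)
      then show ?thesis using T0 Kt[OF t] by (auto simp: b_def)
    qed
    ultimately have "?f t ` \<phi> ` T \<subseteq> inside (\<gamma>t t)" using inside_connected t by blast
    then show ?thesis using z by (auto simp: T_def)
  qed
  obtain F where F: "F holomorphic_on inside \<gamma>" "\<And>z. z \<in> ball 0 1 \<Longrightarrow> F (\<phi> z) = z"
    "\<And>w. w \<in> inside \<gamma> \<Longrightarrow> cmod (F w) < 1 \<and> \<phi> (F w) = w"
    using riemann_map_inverse[OF riemann] by metis
  show thesis
  proof (rule that[of "R + 1" \<tau>])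
    show "inside (\<gamma>t t) \<subseteq> ball 0 (R + 1)" if t: "\<bar>t\<bar> \<le> \<tau>" for t
    proof -
      have sub: "\<gamma>t t \<subseteq> ball 0 (R + 1)"
        unfolding eq[OF t]
      proof clarsimp
        fix x assume "x \<in> \<gamma>"
        then show "cmod (?f t x) < R + 1"
          using near(3)[OF t, of x] R(2)[of x] A1 norm_triangle_sub[of "?f t x" x] by auto
      qed
      have "x \<in> outside (\<gamma>t t)" if "x \<notin> ball 0 (R + 1)" for x
        using convex_in_outside[OF convex_ball that] outside_mono[OF sub] by blast
      then show ?thesis using inside_Int_outside[of "\<gamma>t t"] by blast
    qed
    fix t C assume t: "\<bar>t\<bar> \<le> \<tau>" and C: "compact C" "C \<subseteq> inside (\<gamma>t t)"
    \<comment> \<open>The collar points sent into \<open>C\<close>. This set is compact and misses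
      \<gamma>, because \<open>C\<close> misses the moved curve; its preimage in the disc therefore
      has radius below 1.\<close>
    define P where "P = A \<inter> ?f t -` C"
    have "closed P"
      unfolding P_def
      using continuous_on_closed_vimage[OF compact_imp_closed[OF cA], of "?f t"] contA[OF t] compact_imp_closed[OF C(1)]
      by (simp add: Int_commute)
    then have cP: "compact P"
      using compact_Int_closed[OF cA, of P] by (simp add: P_def Int_absorb1)
    have "P \<inter> \<gamma> = {}"
    proof -
      have "C \<inter> \<gamma>t t = {}" using C(2) inside_no_overlap[of "\<gamma>t t"] by blast
      then show ?thesis unfolding eq[OF t] by (auto simp: P_def)
    qed
    then have PU: "P \<subseteq> inside \<gamma>" by (auto simp: P_def A_def clU)
    have "compact (F ` P)"
      by (rule compact_continuous_image[OF continuous_on_subset[OF holomorphic_on_imp_continuous_on[OF F(1)] PU] cP])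
    have "\<exists>\<delta><1. \<forall>x\<in>F ` P. cmod x \<le> \<delta>"
    proof (cases "P = {}")
      case True
      then show ?thesis by (auto intro!: exI[of _ 0])
    next
      case False
      then obtain x where "x \<in> F ` P" "\<And>y. y \<in> F ` P \<Longrightarrow> cmod y \<le> cmod x"
        using continuous_attains_sup[OF \<open>compact (F ` P)\<close>, of cmod] by (auto intro: continuous_intros)
      then show ?thesis using F(3) PU by (intro exI[of _ "cmod x"]) auto
    qed
    then obtain \<delta> where \<delta>: "\<delta> < 1" "\<And>x. x \<in> P \<Longrightarrow> cmod (F x) \<le> \<delta>" by auto
    have "?f t (\<phi> z) \<notin> C" if z: "max \<delta> \<rho>0 < cmod z" "cmod z < 1" for z
    proof
      assume "?f t (\<phi> z) \<in> C"
      then have "\<phi> z \<in> P" using A2[of z] z by (simp add: P_def)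
      then show False using \<delta>(2)[of "\<phi> z"] F(2)[of z] z by auto
    qed
    then show "\<exists>\<delta><1. \<forall>z. \<delta> < cmod z \<and> cmod z < 1 \<longrightarrow> ?f t (\<phi> z) \<notin> C"
      using \<delta>(1) \<rho> by (intro exI[of _ "max \<delta> \<rho>0"]) auto
  qed (use R \<tau> L Kt ft near(4) A2 in \<open>auto simp: K_def\<close>)
qed

text \<open>Uniform margins for passing from \<open>\<phi>\<close> to \<open>\<xi>\<close> on a
  smaller disc. The factors 2 leave half of each margin for the term t * \<open>\<kappa> z\<close>;
  bounds proportional to |z| also exclude zeros of \<open>\<xi>\<close> other than 0.\<close>

lemma phi_xi_bounds:
  assumes \<rho>: "0 < \<rho>3" "\<rho>3 < \<rho>5" "\<rho>5 < 1"
  obtains \<delta> m N where "\<delta> > 0" "m > 0" "N > 0"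
    "\<And>z. cmod z \<le> \<rho>3 \<Longrightarrow> ball (\<phi> z) (2 * \<delta>) \<subseteq> \<phi> ` cball 0 \<rho>5"
    "\<And>z. cmod z \<le> \<rho>3 \<Longrightarrow> 2 * m * cmod z \<le> cmod (\<phi> z)"
    "\<And>z. cmod z \<le> \<rho>3 \<Longrightarrow> cmod (\<kappa> z) \<le> N * cmod z"
proof -
  have sub: "cball 0 \<rho>3 \<subseteq> ball (0::complex) 1" using \<rho> by auto
  have "compact (\<phi> ` cball 0 \<rho>3)"
    by (rule compact_continuous_image[OF continuous_on_subset[OF cont_phi sub]]) simp
  moreover have "open (\<phi> ` ball 0 \<rho>5)"
    by (rule open_mapping_thm3)
       (use \<rho> in \<open>auto intro: holomorphic_on_subset[OF hol_phi] inj_on_subset[OF inj_phi]\<close>)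
  moreover have "\<phi> ` cball 0 \<rho>3 \<inter> - \<phi> ` ball 0 \<rho>5 = {}" using \<rho> by auto
  ultimately obtain d where d: "d > 0" "\<And>x y. x \<in> \<phi> ` cball 0 \<rho>3 \<Longrightarrow> y \<in> - \<phi> ` ball 0 \<rho>5 \<Longrightarrow> d \<le> dist x y"
    using separate_compact_closed[of "\<phi> ` cball 0 \<rho>3" "- \<phi> ` ball 0 \<rho>5"] by (metis closed_Compl)
  define f where "f z = (if z = 0 then deriv \<phi> 0 else \<phi> z / z)" for z
  have "f holomorphic_on ball 0 1"
    by (rule pole_theorem_open_0[OF hol_phi, of 0]) (auto simp: f_def phi_0)
  then have "continuous_on (cball 0 \<rho>3) f"
    by (intro holomorphic_on_imp_continuous_on) (rule holomorphic_on_subset[OF _ sub])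
  then have "\<exists>x\<in>cball 0 \<rho>3. \<forall>y\<in>cball 0 \<rho>3. cmod (f x) \<le> cmod (f y)"
    by (intro continuous_attains_inf continuous_intros) (use \<rho> in auto)
  then obtain x where x: "cmod x \<le> \<rho>3" "\<And>y. cmod y \<le> \<rho>3 \<Longrightarrow> cmod (f x) \<le> cmod (f y)" by auto
  have fx: "cmod (f x) > 0" using phi_nz[of x] deriv_phi_nz[of 0] x \<rho> by (auto simp: f_def)
  have "bounded ((\<lambda>z. deriv \<phi> z * h z) ` cball 0 \<rho>3)"
    by (intro compact_imp_bounded compact_continuous_image continuous_on_mult
         continuous_on_subset[OF holomorphic_on_imp_continuous_on[OF holomorphic_deriv[OF hol_phi]] sub]
         continuous_on_subset[OF holomorphic_on_imp_continuous_on[OF hol_h] sub]) auto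
  then obtain N where N: "N > 0" "\<And>z. cmod z \<le> \<rho>3 \<Longrightarrow> cmod (deriv \<phi> z * h z) \<le> N"
    by (auto simp: bounded_pos)
  show thesis
  proof (rule that)
    show "d / 2 > 0" "cmod (f x) / 2 > 0" "N > 0" using d fx N by auto
    fix z :: complex assume z: "cmod z \<le> \<rho>3"
    show "ball (\<phi> z) (2 * (d / 2)) \<subseteq> \<phi> ` cball 0 \<rho>5"
    proof
      fix y assume "y \<in> ball (\<phi> z) (2 * (d / 2))"
      then have "y \<in> \<phi> ` ball 0 \<rho>5" using d(2)[of "\<phi> z" y] z by (auto simp: not_le)
      then show "y \<in> \<phi> ` cball 0 \<rho>5" by auto
    qed
    have "cmod (f x) * cmod z \<le> cmod (f z) * cmod z" using x(2)[OF z] by (rule mult_right_mono) simp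
    also have "\<dots> = cmod (\<phi> z)" by (auto simp: f_def phi_0 norm_divide)
    finally show "2 * (cmod (f x) / 2) * cmod z \<le> cmod (\<phi> z)" by simp
    have "cmod (\<kappa> z) = cmod (deriv \<phi> z * h z) * cmod z" by (simp add: \<kappa>_def norm_mult)
    also have "\<dots> \<le> N * cmod z" using N(2)[OF z] by (rule mult_right_mono) simp
    finally show "cmod (\<kappa> z) \<le> N * cmod z" .
  qed
qed

text \<open>The constant may depend on \<open>z0\<close>, through radii chosen beyond |z0|. This
  suffices because the action on the Riemann map is pointwise.\<close>

lemma phi_plus_expansion:
  assumes z0: "cmod z0 < 1"
  shows "\<exists>C. \<forall>\<^sub>F t in at (0::real). cmod (phi_plus (\<gamma>t t) z0 - \<xi> (of_real t) z0) \<le> C * t\<^sup>2"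
proof -
  define s where "s = cmod z0"
  have s: "0 \<le> s" "s < 1" using z0 by (auto simp: s_def)
  \<comment> \<open>\<rho>0 is the inner edge of the annulus for \<open>q\<close>. The circle
    \<rho>1 serves the passage from \<open>q\<close> to \<open>p\<close> and \<rho>2 the passage
    back, whose displaced points stay beyond \<rho>1'. \<open>p\<close> lives on the disc of radius
    \<rho>3, and \<rho>5 leaves room for \<open>\<xi>\<close> around the image of that disc.\<close>
  obtain \<rho>0 \<rho>1 \<rho>1' \<rho>2 \<rho>3 \<rho>5 where \<rho>: "s < \<rho>0" "\<rho>0 < \<rho>1" "\<rho>1 < \<rho>1'" "\<rho>1' < \<rho>2" "\<rho>2 < \<rho>3" "\<rho>3 < \<rho>5" "\<rho>5 < 1"
    using s(2) by (meson dense)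
  have \<rho>0: "\<rho>0 > 0" using s \<rho> by simp
  obtain B \<tau>0 where B: "B > 0" and \<tau>0: "\<tau>0 > 0"
    and Loop: "\<And>t. \<bar>t\<bar> \<le> \<tau>0 \<Longrightarrow> \<gamma>t t \<in> Loop1"
    and K: "\<And>t. \<bar>t\<bar> \<le> \<tau>0 \<Longrightarrow> \<phi> ` cball 0 \<rho>5 \<subseteq> inside (\<gamma>t t)"
    and inB: "\<And>t. \<bar>t\<bar> \<le> \<tau>0 \<Longrightarrow> inside (\<gamma>t t) \<subseteq> ball 0 B"
    and dom: "\<And>t z. \<bar>t\<bar> \<le> \<tau>0 \<Longrightarrow> \<rho>0 \<le> cmod z \<Longrightarrow> cmod z < 1 \<Longrightarrow> (of_real t, \<phi> z) \<in> flow_domain n"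
    and flow_in: "\<And>t z. \<bar>t\<bar> \<le> \<tau>0 \<Longrightarrow> \<rho>0 \<le> cmod z \<Longrightarrow> cmod z < 1 \<Longrightarrow> power_flow n (of_real t) (\<phi> z) \<in> inside (\<gamma>t t)"
    and proper: "\<And>t C. \<bar>t\<bar> \<le> \<tau>0 \<Longrightarrow> compact C \<Longrightarrow> C \<subseteq> inside (\<gamma>t t) \<Longrightarrow>
       \<exists>\<delta><1. \<forall>z. \<delta> < cmod z \<and> cmod z < 1 \<longrightarrow> power_flow n (of_real t) (\<phi> z) \<notin> C"
    by (rule perturbed_loop[of \<rho>0 \<rho>5]) (use \<rho> \<rho>0 in auto)
  obtain \<delta> m N where dmN: "\<delta> > 0" "m > 0" "N > 0"
    and \<delta>: "\<And>z. cmod z \<le> \<rho>3 \<Longrightarrow> ball (\<phi> z) (2 * \<delta>) \<subseteq> \<phi> ` cball 0 \<rho>5"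
    and m: "\<And>z. cmod z \<le> \<rho>3 \<Longrightarrow> 2 * m * cmod z \<le> cmod (\<phi> z)"
    and N: "\<And>z. cmod z \<le> \<rho>3 \<Longrightarrow> cmod (\<kappa> z) \<le> N * cmod z"
    by (rule phi_xi_bounds[of \<rho>3 \<rho>5]) (use \<rho> \<rho>0 in auto)
  obtain C1 \<tau>1 where C1: "C1 > 0" "\<tau>1 > 0" "\<And>z t. cmod z = \<rho>1 \<Longrightarrow> cmod t < \<tau>1 \<Longrightarrow>
     cmod (power_flow n t (\<phi> z) - \<xi> t (\<Psi> t z)) \<le> C1 * (cmod t)\<^sup>2"
    using flow_vs_xi_Psi[of \<rho>1] \<rho> \<rho>0 by auto
  obtain C2 \<tau>2 where C2: "C2 > 0" "\<tau>2 > 0" "\<And>z t. cmod z = \<rho>2 \<Longrightarrow> cmod t < \<tau>2 \<Longrightarrow>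
     cmod (power_flow n t (\<phi> (\<Psi> (- t) z)) - \<xi> t z) \<le> C2 * (cmod t)\<^sup>2"
    using flow_Psi_vs_xi[of \<rho>2] \<rho> \<rho>0 by auto
  obtain C3 \<tau>3 where C3: "C3 > 0" "\<tau>3 > 0" "\<And>z t. cmod z = \<rho>2 \<Longrightarrow> cmod t < \<tau>3 \<Longrightarrow>
     cmod (exp (t * (w (\<Psi> (- t) z) - w z)) - 1) \<le> C3 * (cmod t)\<^sup>2"
    using Psi_Psi_quadratic[of \<rho>2] \<rho> \<rho>0 by auto
  obtain \<tau>4 where \<tau>4: "\<tau>4 > 0" "\<And>z t. cmod z = \<rho>1 \<Longrightarrow> cmod t \<le> \<tau>4 \<Longrightarrow>
     \<rho>1 - min (\<rho>2 - \<rho>1) (\<rho>1 - \<rho>0) < cmod (\<Psi> t z) \<and> cmod (\<Psi> t z) < \<rho>1 + min (\<rho>2 - \<rho>1) (\<rho>1 - \<rho>0)"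
    by (rule Psi_displacement[of \<rho>1 "min (\<rho>2 - \<rho>1) (\<rho>1 - \<rho>0)"]) (use \<rho> \<rho>0 in auto)
  obtain \<tau>5 where \<tau>5: "\<tau>5 > 0" "\<And>z t. cmod z = \<rho>2 \<Longrightarrow> cmod t \<le> \<tau>5 \<Longrightarrow>
     \<rho>2 - min (\<rho>2 - \<rho>1') (1 - \<rho>2) < cmod (\<Psi> t z) \<and> cmod (\<Psi> t z) < \<rho>2 + min (\<rho>2 - \<rho>1') (1 - \<rho>2)"
    by (rule Psi_displacement[of \<rho>2 "min (\<rho>2 - \<rho>1') (1 - \<rho>2)"]) (use \<rho> \<rho>0 in auto)
  define \<tau> where "\<tau> = Min {\<tau>0, \<tau>1, \<tau>2, \<tau>3, \<tau>4, \<tau>5}"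
  have \<tau>: "\<tau> > 0" using \<tau>0 C1 C2 C3 \<tau>4 \<tau>5 by (simp add: \<tau>_def)
  define C where "C = C1 + C2"
  have C: "C > 0" using C1 C2 by (simp add: C_def)
  \<comment> \<open>A displacement C t^2 is enlarged by \<open>F\<close> at most by 2 / \<delta>, as
    |F| < 1 on balls of radius \<delta>. Dividing by the lower bound m \<rho>0 / (2 B) for |p| turns
    this into the relative error D t^2.\<close>
  define D where "D = 2 / \<delta> * C * (2 * B / (m * \<rho>0))"
  have D: "D > 0" using dmN C B \<rho>0 by (simp add: D_def)
  define E where "E = (1 + ln \<rho>1' / ln \<rho>1) / (1 - ln \<rho>1' / ln \<rho>1)"
  have E0: "E > 0"
  proof -
    have "0 < ln \<rho>1' / ln \<rho>1" "ln \<rho>1' / ln \<rho>1 < 1" using \<rho> \<rho>0 by (auto simp: field_simps)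
    then show ?thesis unfolding E_def by auto
  qed
  \<comment> \<open>Adds the relative errors from comparing \<open>p\<close> with \<open>q\<close>
    and from the inexact cancellation of \<open>\<Psi>\<close>, each doubled by the passage to
    exponentials.\<close>
  define Q where "Q = 2 * D + 2 * C3"
  have Q: "Q > 0" using D C3 by (simp add: Q_def)
  define \<sigma> where "\<sigma> = s / \<rho>2"
  have \<sigma>: "\<sigma> < 1" "s = \<sigma> * \<rho>2" using s \<rho> by (auto simp: \<sigma>_def)
  define G where "G = 16 / (1 - \<sigma>) * (Q * E)"
  have G: "G > 0" using \<sigma> Q E0 by (simp add: G_def)
  have ev: "\<forall>\<^sub>F t in at (0::real). \<bar>t\<bar> * c < b" "\<forall>\<^sub>F t in at (0::real). t\<^sup>2 * c < b" if "b > 0" for b c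
  proof -
    have "((\<lambda>t::real. \<bar>t\<bar> * c) \<longlongrightarrow> \<bar>0\<bar> * c) (at 0)" "((\<lambda>t::real. t\<^sup>2 * c) \<longlongrightarrow> 0\<^sup>2 * c) (at 0)"
      by (intro tendsto_intros)+
    from order_tendstoD(2)[OF this(1), of b] order_tendstoD(2)[OF this(2), of b] that
    show "\<forall>\<^sub>F t in at (0::real). \<bar>t\<bar> * c < b" "\<forall>\<^sub>F t in at (0::real). t\<^sup>2 * c < b" by auto
  qed
  have half: "0 < (1 / 2 :: real)" and quarter: "0 < (1 / 4 :: real)" and s1: "0 < 1 - s"
    using s by auto
  have "\<forall>\<^sub>F t in at (0::real). cmod (phi_plus (\<gamma>t t) z0 - \<xi> (of_real t) z0) \<le> 2 * B / (1 - s) * G * t\<^sup>2"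
    using eventually_at_0_realI[OF \<tau>, of "\<lambda>t. t \<noteq> 0 \<and> \<bar>t\<bar> < \<tau>", simplified]
      ev(1)[OF dmN(1), of N] ev(1)[OF dmN(2), of N] ev(1)[OF half, of \<eta>] ev(2)[OF dmN(1), of C]
      ev(2)[OF half, of D] ev(2)[OF half, of C3] ev(2)[OF quarter, of "Q * E"] ev(2)[OF s1, of G]
      ev(1)[OF half, of "- \<eta>"]
  proof eventually_elim
    case (elim t)
    note elim = elim[simplified]
    define T where "T = complex_of_real t"
    have t: "\<bar>t\<bar> \<le> \<tau>0" "cmod T < \<tau>1" "cmod T < \<tau>2" "cmod T < \<tau>3" "cmod T \<le> \<tau>4" "cmod (- T) \<le> \<tau>5"
      using elim(1) by (auto simp: \<tau>_def T_def)
    have cT: "(cmod T)\<^sup>2 = t\<^sup>2" by (simp add: T_def)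
    define U where "U = inside (\<gamma>t t)"
    define \<phi>t where "\<phi>t = phi_plus (\<gamma>t t)"
    have rt: "normalized_riemann_map U \<phi>t"
      unfolding U_def \<phi>t_def by (rule phi_plus_normalized[OF Loop[OF t(1)]])
    have oU: "open U" unfolding U_def by (rule Loop1_inside(1)[OF Loop[OF t(1)]])
    obtain F where F: "F holomorphic_on U" "\<And>z. z \<in> ball 0 1 \<Longrightarrow> F (\<phi>t z) = z"
      "\<And>w. w \<in> U \<Longrightarrow> cmod (F w) < 1 \<and> \<phi>t (F w) = w" "deriv \<phi>t 0 * deriv F 0 = 1"
      using riemann_map_inverse[OF rt] by metis
    have hol\<phi>t: "\<phi>t holomorphic_on ball 0 1" and im\<phi>t: "\<phi>t ` ball 0 1 = U" and \<phi>t0: "\<phi>t 0 = 0"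
      using rt by (auto simp: normalized_riemann_map_def bij_betw_def)
    have \<phi>tB: "cmod (\<phi>t z) < B" if "z \<in> ball 0 1" for z
    proof -
      have "\<phi>t z \<in> U" using im\<phi>t that by blast
      then show ?thesis using inB[OF t(1)] by (auto simp: U_def)
    qed
    have F0: "F 0 = 0" using F(2)[of 0] \<phi>t0 by simp
    \<comment> \<open>The upper Schwarz bound for \<open>\<phi>t\<close> read backwards is a lower
      bound for its inverse. It is uniform in t because all perturbed interiors lie in one
      ball.\<close>
    have F_lower: "cmod x \<le> 2 * B * cmod (F x)" if "x \<in> U" for x
      using bounded_holomorphic_lipschitz[OF hol\<phi>t \<phi>tB, of "F x"] F(3)[OF that] \<phi>t0 by simp
    have F_nz: "F x \<noteq> 0" if "x \<in> U" "x \<noteq> 0" for x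
      using F_lower[OF that(1)] that(2) by auto
    have \<xi>_near: "cmod (\<xi> T z - \<phi> z) < \<delta>" if z: "cmod z \<le> \<rho>3" for z
    proof -
      have "cmod (\<xi> T z - \<phi> z) = \<bar>t\<bar> * cmod (\<kappa> z)" by (simp add: \<xi>_def T_def norm_mult)
      also have "\<dots> \<le> \<bar>t\<bar> * (N * 1)"
        using N[OF z] dmN z \<rho> by (intro mult_left_mono order_trans[OF N[OF z]]) auto
      also have "\<dots> < \<delta>" using elim(2) by simp
      finally show ?thesis .
    qed
    have \<xi>_ball: "ball (\<xi> T z) \<delta> \<subseteq> U" if z: "cmod z \<le> \<rho>3" for z
    proof -
      have "ball (\<xi> T z) \<delta> \<subseteq> ball (\<phi> z) (2 * \<delta>)"
        using \<xi>_near[OF z] by (simp add: ball_subset_ball_iff dist_norm)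
      then show ?thesis using \<delta>[OF z] K[OF t(1)] unfolding U_def by blast
    qed
    have \<xi>_in: "\<xi> T z \<in> U" if "cmod z \<le> \<rho>3" for z
      using \<xi>_ball[OF that] dmN by auto
    have \<xi>_lower: "m * cmod z \<le> cmod (\<xi> T z)" if z: "cmod z \<le> \<rho>3" for z
    proof -
      have "cmod (\<phi> z) \<le> cmod (\<xi> T z) + cmod (T * \<kappa> z)"
        using norm_triangle_ineq4[of "\<xi> T z" "T * \<kappa> z"] by (simp add: \<xi>_def)
      also have "cmod (T * \<kappa> z) \<le> \<bar>t\<bar> * (N * cmod z)"
        using N[OF z] by (simp add: T_def norm_mult mult_left_mono)
      also have "\<dots> \<le> m * cmod z"
        using mult_right_mono[OF less_imp_le[OF elim(3)], of "cmod z"] by (simp add: mult.assoc)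
      finally show ?thesis using m[OF z] by simp
    qed
    define p where "p z = F (\<xi> T z)" for z
    define q where "q z = F (power_flow n T (\<phi> z))" for z
    have compare: "cmod (F b) \<le> exp (2 * (D * t\<^sup>2)) * cmod (p z) \<and> cmod (p z) \<le> exp (2 * (D * t\<^sup>2)) * cmod (F b)"
      if z: "\<rho>0 \<le> cmod z" "cmod z \<le> \<rho>3" and b: "cmod (b - \<xi> T z) \<le> C * t\<^sup>2" for z b
    proof -
      have pz: "cmod (p z) \<ge> m * \<rho>0 / (2 * B)"
      proof -
        have "m * \<rho>0 \<le> m * cmod z" using z dmN by simp
        also have "\<dots> \<le> 2 * B * cmod (p z)"
          using \<xi>_lower[OF z(2)] F_lower[OF \<xi>_in[OF z(2)]] by (simp add: p_def)
        finally show ?thesis using B by (simp add: field_simps)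
      qed
      have pos: "m * \<rho>0 / (2 * B) > 0" using dmN \<rho>0 B by simp
      then have p0: "cmod (p z) > 0" using pz by linarith
      have "cmod (F b - p z) \<le> 2 * 1 / \<delta> * cmod (b - \<xi> T z)"
        unfolding p_def
      proof (rule bounded_holomorphic_lipschitz)
        show "F holomorphic_on ball (\<xi> T z) \<delta>" by (rule holomorphic_on_subset[OF F(1) \<xi>_ball[OF z(2)]])
        show "cmod (F x) < 1" if "x \<in> ball (\<xi> T z) \<delta>" for x using F(3) \<xi>_ball[OF z(2)] that by auto
        show "cmod (b - \<xi> T z) < \<delta>" using b elim(5) by (simp add: mult.commute)
      qed
      also have "\<dots> \<le> 2 / \<delta> * (C * t\<^sup>2)" using b dmN by (simp add: divide_right_mono)
      also have "\<dots> = D * t\<^sup>2 * (m * \<rho>0 / (2 * B))" using dmN \<rho>0 B by (simp add: D_def)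
      also have "\<dots> \<le> D * t\<^sup>2 * cmod (p z)" using pz D by (intro mult_left_mono) auto
      finally have le: "cmod (F b - p z) \<le> D * t\<^sup>2 * cmod (p z)" .
      have "F b / p z - 1 = (F b - p z) / p z" using p0 by (simp add: field_simps)
      then have "cmod (F b / p z - 1) \<le> D * t\<^sup>2"
        using le p0 by (simp add: norm_divide divide_le_eq)
      from cmod_bounds_exp[OF this] elim(6) p0 show ?thesis
        by (simp add: norm_divide divide_simps mult_ac split: if_splits)
    qed
    have hol\<xi>: "\<xi> T holomorphic_on ball 0 1"
      unfolding \<xi>_def[abs_def] by (intro holomorphic_intros hol_phi hol_kappa)
    obtain a b where ab: "deriv \<phi> 0 = of_real a" "a > 0" "deriv \<phi>t 0 = of_real b" "b > 0"
      using riemann rt by (auto simp: normalized_riemann_map_def elim!: Reals_cases)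
    have "(\<kappa> has_field_derivative deriv \<phi> 0 * h 0) (at 0)"
    proof -
      have "((\<lambda>z. deriv \<phi> z * h z) has_field_derivative deriv (\<lambda>z. deriv \<phi> z * h z) 0) (at 0)"
        by (rule holomorphic_derivI[of _ "ball 0 1"])
           (auto intro!: holomorphic_intros hol_h holomorphic_deriv[OF hol_phi])
      from DERIV_mult[OF DERIV_ident this] show ?thesis
        by (simp add: \<kappa>_def[abs_def] mult_ac)
    qed
    then have "(\<xi> T has_field_derivative deriv \<phi> 0 + T * (deriv \<phi> 0 * h 0)) (at 0)"
      unfolding \<xi>_def[abs_def] by (intro DERIV_add DERIV_phi DERIV_cmult) auto
    moreover have "(F has_field_derivative deriv F 0) (at (\<xi> T 0))"
      using holomorphic_derivI[OF F(1) oU, of 0] \<xi>_in[of 0] \<rho> \<rho>0 by (simp add: \<xi>_def \<kappa>_def phi_0)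
    ultimately have "(p has_field_derivative deriv F 0 * (deriv \<phi> 0 + T * (deriv \<phi> 0 * h 0))) (at 0)"
      unfolding p_def[abs_def] by (rule DERIV_chain2[rotated])
    then have "deriv p 0 = deriv F 0 * (deriv \<phi> 0 + T * (deriv \<phi> 0 * h 0))" by (rule DERIV_imp_deriv)
    also have "deriv F 0 = of_real (1 / b)" using F(4) ab by (simp add: field_simps)
    \<comment> \<open>Here \<open>h 0\<close> being real matters: the derivative of \<open>p\<close>
      at 0 is real, so no rotation has to be determined.\<close>
    finally have dp: "deriv p 0 = of_real (a / b * (1 + t * \<eta>))"
      by (simp add: ab h0 T_def algebra_simps)
    \<comment> \<open>\<eta> may have either sign; the smallness conditions for \<eta> and for
      -\<eta> together bound the modulus.\<close>
    have "\<bar>t * \<eta>\<bar> < 1" using elim(4,10) unfolding abs_mult by linarith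
    then have dp_pos: "0 < a / b * (1 + t * \<eta>)" using ab by (intro mult_pos_pos) auto
    have "cmod (p z0 - z0) \<le> 16 / (1 - \<sigma>) * (Q * t\<^sup>2 * E) * cmod z0"
    proof (rule compared_on_circles_near_identity[where q = q and v = "\<Psi> T" and \<kappa> = "Q * t\<^sup>2" and \<sigma> = \<sigma>
          and x = "a / b * (1 + t * \<eta>)" and ?\<rho>0.0 = \<rho>0 and ?\<rho>1.0 = \<rho>1 and \<rho>1' = \<rho>1' and ?\<rho>2.0 = \<rho>2 and ?\<rho>3.0 = \<rho>3])
      show "p holomorphic_on ball 0 \<rho>3"
        unfolding p_def[abs_def]
        by (rule holomorphic_on_compose_gen[OF holomorphic_on_subset[OF hol\<xi>] F(1), unfolded o_def])
           (use \<rho> \<xi>_in in auto)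
      show "p 0 = 0" using F0 by (simp add: p_def \<xi>_def \<kappa>_def phi_0)
      show "p z \<noteq> 0" if z: "0 < cmod z" "cmod z < \<rho>3" for z
        unfolding p_def
      proof (rule F_nz)
        have "0 < m * cmod z" using z dmN by simp
        then show "\<xi> T z \<noteq> 0" using \<xi>_lower[of z] z by auto
      qed (use \<xi>_in z in auto)
      show "q holomorphic_on {z. \<rho>0 < cmod z \<and> cmod z < 1}"
        unfolding q_def[abs_def]
      proof (rule holomorphic_on_compose_gen[OF _ F(1), unfolded o_def])
        show "(\<lambda>z. power_flow n T (\<phi> z)) holomorphic_on {z. \<rho>0 < cmod z \<and> cmod z < 1}"
          by (intro holomorphic_intros holomorphic_on_subset[OF hol_phi]) (use dom[OF t(1)] in \<open>auto simp: T_def\<close>)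
      qed (use flow_in[OF t(1)] in \<open>auto simp: T_def U_def\<close>)
      show "q z \<noteq> 0 \<and> cmod (q z) < 1" if z: "\<rho>0 < cmod z" "cmod z < 1" for z
      proof -
        have "power_flow n T (\<phi> z) \<in> U" using flow_in[OF t(1)] z by (auto simp: T_def U_def)
        moreover have "0 < cmod z" using z \<rho>0 by linarith
        then have "power_flow n T (\<phi> z) \<noteq> 0" using phi_nz[of z] z by simp
        ultimately show ?thesis using F_nz F(3) by (auto simp: q_def)
      qed
      show "\<exists>\<delta><1. \<forall>z. \<delta> < cmod z \<and> cmod z < 1 \<longrightarrow> 1 - \<epsilon> < cmod (q z)" if \<epsilon>: "0 < \<epsilon>" "\<epsilon> < 1" for \<epsilon>
      proof -
        \<comment> \<open>If |q z| were at most 1 - \<epsilon>, the moved point would lie in this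
          compact part of the perturbed interior, which is impossible close to the unit
          circle.\<close>
        have cc: "compact (\<phi>t ` cball 0 (1 - \<epsilon>))"
          by (intro compact_continuous_image holomorphic_on_imp_continuous_on holomorphic_on_subset[OF hol\<phi>t])
             (use \<epsilon> in auto)
        have cs: "\<phi>t ` cball 0 (1 - \<epsilon>) \<subseteq> inside (\<gamma>t t)"
          using im\<phi>t \<epsilon> by (auto simp: U_def)
        obtain d where d: "d < 1" "\<And>z. d < cmod z \<Longrightarrow> cmod z < 1 \<Longrightarrow> power_flow n T (\<phi> z) \<notin> \<phi>t ` cball 0 (1 - \<epsilon>)"
          using proper[OF t(1) cc cs] by (auto simp: T_def)
        have "1 - \<epsilon> < cmod (q z)" if z: "max d \<rho>0 < cmod z" "cmod z < 1" for z
        proof (rule ccontr)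
          assume "\<not> 1 - \<epsilon> < cmod (q z)"
          then have "\<phi>t (q z) \<in> \<phi>t ` cball 0 (1 - \<epsilon>)" by auto
          moreover have "\<phi>t (q z) = power_flow n T (\<phi> z)"
            using F(3) flow_in[OF t(1), of z] z by (auto simp: q_def T_def U_def)
          ultimately show False using d(2)[of z] z by simp
        qed
        then show ?thesis using d \<rho> by (intro exI[of _ "max d \<rho>0"]) auto
      qed
      \<comment> \<open>Since \<open>T\<close> is real and \<open>w z\<close> is imaginary on the
        unit circle, the exponential factor has modulus 1.\<close>
      show "cmod (\<Psi> T z) = 1" if "cmod z = 1" for z
        using tangential[OF that] that by (simp add: \<Psi>_def norm_mult T_def)
      have Q1: "exp (2 * (D * t\<^sup>2)) \<le> exp (Q * t\<^sup>2)" using C3 by (simp add: Q_def algebra_simps)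
      show "cmod (\<Psi> T z) \<le> \<rho>2 \<and> cmod (q z) \<le> exp (Q * t\<^sup>2) * cmod (p (\<Psi> T z)) \<and> cmod (p (\<Psi> T z)) \<le> exp (Q * t\<^sup>2) * cmod (q z)"
        if z: "cmod z = \<rho>1" for z
      proof -
        have Pz: "\<rho>0 \<le> cmod (\<Psi> T z)" "cmod (\<Psi> T z) \<le> \<rho>2" using \<tau>4(2)[OF z t(5)] by auto
        have "C1 * t\<^sup>2 \<le> C * t\<^sup>2" using C2 by (intro mult_right_mono) (auto simp: C_def)
        then have "cmod (power_flow n T (\<phi> z) - \<xi> T (\<Psi> T z)) \<le> C * t\<^sup>2"
          using C1(3)[OF z t(2)] cT by simp
        from compare[OF Pz(1) _ this] Pz \<rho> show ?thesis
          unfolding q_def[symmetric] using Q1 by (smt (verit) mult_right_mono norm_ge_zero)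
      qed
      show "\<exists>z'. \<rho>1' \<le> cmod z' \<and> cmod z' < 1 \<and> cmod (p z / z) \<le> exp (Q * t\<^sup>2) * cmod (q z' / \<Psi> T z') \<and>
              cmod (q z' / \<Psi> T z') \<le> exp (Q * t\<^sup>2) * cmod (p z / z)"
        if z: "cmod z = \<rho>2" for z
      proof -
        \<comment> \<open>An approximate preimage of \<open>z\<close> under \<open>\<Psi> T\<close>;
          the factor \<open>x\<close> below measures the second-order defect.\<close>
        define z' where "z' = \<Psi> (- T) z"
        have z': "\<rho>1' \<le> cmod z'" "cmod z' < 1" using \<tau>5(2)[OF z t(6)] by (auto simp: z'_def)
        have z0: "z \<noteq> 0" using z \<rho> \<rho>0 by auto
        define x where "x = exp (T * (w z' - w z))"
        have Pz': "\<Psi> T z' = z * x"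
          unfolding x_def by (subst \<Psi>_def, subst (1) z'_def, subst \<Psi>_def) (simp add: exp_add[symmetric] algebra_simps)
        have x: "cmod x \<le> exp (2 * (C3 * t\<^sup>2))" "1 \<le> exp (2 * (C3 * t\<^sup>2)) * cmod x"
          using cmod_bounds_exp[of x "C3 * t\<^sup>2"] C3(3)[OF z t(4)] elim(7) cT by (auto simp: x_def z'_def mult.commute)
        have x0: "cmod x > 0" by (simp add: x_def)
        have "C2 * t\<^sup>2 \<le> C * t\<^sup>2" using C1 by (intro mult_right_mono) (auto simp: C_def)
        then have "cmod (power_flow n T (\<phi> z') - \<xi> T z) \<le> C * t\<^sup>2"
          using C2(3)[OF z t(3)] cT by (simp add: z'_def)
        from compare[OF _ _ this] z \<rho>
        have pq: "cmod (q z') \<le> exp (2 * (D * t\<^sup>2)) * cmod (p z)" "cmod (p z) \<le> exp (2 * (D * t\<^sup>2)) * cmod (q z')"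
          unfolding q_def[symmetric] by auto
        have eQ: "exp (Q * t\<^sup>2) = exp (2 * (D * t\<^sup>2)) * exp (2 * (C3 * t\<^sup>2))"
          by (simp add: Q_def exp_add[symmetric] algebra_simps)
        have qx: "cmod (q z' / \<Psi> T z') = cmod (q z') / (cmod z * cmod x)"
          by (simp add: Pz' norm_divide norm_mult)
        have "cmod (p z) * cmod x \<le> (exp (2 * (D * t\<^sup>2)) * cmod (q z')) * exp (2 * (C3 * t\<^sup>2))"
          using pq x by (intro mult_mono) auto
        then have 1: "cmod (p z / z) \<le> exp (Q * t\<^sup>2) * cmod (q z' / \<Psi> T z')"
          unfolding qx eQ using x0 z0 by (simp add: norm_divide field_simps)
        have "cmod (q z') * 1 \<le> (exp (2 * (D * t\<^sup>2)) * cmod (p z)) * (exp (2 * (C3 * t\<^sup>2)) * cmod x)"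
          using pq x by (intro mult_mono) auto
        then have 2: "cmod (q z' / \<Psi> T z') \<le> exp (Q * t\<^sup>2) * cmod (p z / z)"
          unfolding qx eQ using x0 z0 by (simp add: norm_divide field_simps)
        show ?thesis using z' 1 2 by blast
      qed
      show "E = (1 + ln \<rho>1' / ln \<rho>1) / (1 - ln \<rho>1' / ln \<rho>1)" by (rule E_def)
      show "0 < Q * t\<^sup>2" using Q elim(1) by simp
      show "Q * t\<^sup>2 * E \<le> 1 / 4" using elim(8) by (simp add: mult_ac)
      show "cmod z0 \<le> \<sigma> * \<rho>2" using \<sigma>(2) by (simp add: s_def)
    qed (use \<rho> \<rho>0 \<sigma> hol_Psi dp dp_pos in auto)
    also have "\<dots> \<le> 16 / (1 - \<sigma>) * (Q * t\<^sup>2 * E) * 1"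
      using z0 \<sigma> Q E0 by (intro mult_left_mono) auto
    also have "\<dots> = G * t\<^sup>2" by (simp add: G_def)
    finally have le: "cmod (p z0 - z0) \<le> G * t\<^sup>2" .
    \<comment> \<open>Applying \<open>\<phi>t\<close> to the estimate for \<open>p\<close> returns
      to the perturbed domain, where \<phi>t (p z0) is \<open>\<xi> T z0\<close>.\<close>
    have "cmod (\<phi>t (p z0) - \<phi>t z0) \<le> 2 * B / (1 - s) * cmod (p z0 - z0)"
    proof (rule bounded_holomorphic_lipschitz)
      have sub: "ball z0 (1 - s) \<subseteq> ball 0 1" by (simp add: ball_subset_ball_iff s_def)
      show "\<phi>t holomorphic_on ball z0 (1 - s)" by (rule holomorphic_on_subset[OF hol\<phi>t sub])
      show "cmod (\<phi>t x) < B" if "x \<in> ball z0 (1 - s)" for x using \<phi>tB that sub by blast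
      show "cmod (p z0 - z0) < 1 - s" using le elim(9) by (simp add: mult.commute)
    qed
    also have "\<dots> \<le> 2 * B / (1 - s) * (G * t\<^sup>2)" using le B s by (intro mult_left_mono) auto
    finally have "cmod (\<phi>t (p z0) - \<phi>t z0) \<le> 2 * B / (1 - s) * G * t\<^sup>2" by (simp add: mult.assoc)
    moreover have "\<phi>t (p z0) = \<xi> T z0" using F(3) \<xi>_in[of z0] \<rho> by (auto simp: p_def s_def)
    ultimately show ?case by (simp add: \<phi>t_def T_def norm_minus_commute)
  qed
  then show ?thesis by blast
qed

lemma has_L_action_phi_plus:
  assumes \<phi>: "\<phi> = phi_plus \<gamma>" and z: "cmod z < 1"
  shows "has_L_action n (\<lambda>\<gamma>'. phi_plus \<gamma>' z) \<gamma> (deriv \<phi> z * (z * h z))"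
  unfolding has_L_action_def
proof -
  obtain C where C: "\<forall>\<^sub>F t in at (0::real). cmod (phi_plus (\<gamma>t t) z - \<xi> (of_real t) z) \<le> C * t\<^sup>2"
    using phi_plus_expansion[OF z] by blast
  have "\<gamma>t 0 = power_flow n (of_real 0) ` \<gamma>"
    by (rule exp_L_eq_power_flow_image) (use \<gamma> in \<open>auto simp: flow_domain_def Loop1_def\<close>)
  then have start: "phi_plus (exp_L n 0 \<gamma>) z = \<phi> z" by (simp add: \<phi>)
  then show "((\<lambda>t. phi_plus (\<gamma>t t) z) has_vector_derivative deriv \<phi> z * (z * h z)) (at 0)"
    using C by (intro has_vector_derivative_at_0_quadraticI[where C = C])
      (simp add: \<xi>_def \<kappa>_def start scaleR_conv_of_real)
qed

end

section \<open>From the split of the pulled-back field to the two Laurent formulas\<close>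

theorem corollary4p9:
  fixes n :: int and \<gamma> :: "complex set"
    and \<phi> f :: "complex \<Rightarrow> complex" and a c :: "int \<Rightarrow> complex" and R :: complex
  assumes "\<gamma> \<in> Loop1"
    and "\<phi> = phi_plus \<gamma>"
    and "f = (\<lambda>z. \<phi> z powi (n + 1) / deriv \<phi> z)"
    and "a = laurent_pos (\<lambda>k. laurent_coeff f k
               + laurent_star (laurent_coeff (\<lambda>z. z powi (-2) * f z)) k)"
    and "R = Res0 (\<lambda>s. \<phi> s powi (n + 1) / (deriv \<phi> s * s ^ 2))"
    and "c = laurent_coeff f"
  shows
    "(\<forall>k < n + 1. c k = 0) \<and>
     (\<forall>z. 0 < cmod z \<and> cmod z < 1 \<longrightarrow> ((\<lambda>k. c k * z powi k) has_sum f z) {n + 1..}) \<and>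
     (\<forall>z \<in> ball 0 1.
        (\<lambda>k. a k * z powi k) summable_on UNIV \<and>
        (\<lambda>k. (c k + cnj (c (2 - k))) * z powi k) summable_on {1<..} \<and>
        has_L_action n (\<lambda>\<gamma>'. phi_plus \<gamma>' z) \<gamma>
          (deriv \<phi> z * ((\<Sum>\<^sub>\<infinity>k\<in>UNIV. a k * z powi k) - 1 / 2 * z * (R + cnj R))) \<and>
        deriv \<phi> z * ((\<Sum>\<^sub>\<infinity>k\<in>UNIV. a k * z powi k) - 1 / 2 * z * (R + cnj R))
        = deriv \<phi> z * (1 / 2 * (c 1 + cnj (c 1)) * z
            + (\<Sum>\<^sub>\<infinity>k\<in>{1<..}. (c k + cnj (c (2 - k))) * z powi k)))"
proof -
  have riem: "normalized_riemann_map (inside \<gamma>) \<phi>"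
    using phi_plus_normalized assms(1,2) by simp
  then have hol: "\<phi> holomorphic_on ball 0 1" and inj: "inj_on \<phi> (ball 0 1)" and \<phi>0: "\<phi> 0 = 0"
    by (auto simp: normalized_riemann_map_def bij_betw_def)
  have d: "deriv \<phi> z \<noteq> 0" if "z \<in> ball 0 1" for z
    using holomorphic_injective_imp_regular[OF hol open_ball inj that] .
  \<comment> \<open>Removing the simple zero of \<open>\<phi>\<close> leaves a zero-free holomorphic
    function, so its integer powers are holomorphic for every sign of n + 1.\<close>
  define \<psi> where "\<psi> z = (if z = 0 then deriv \<phi> 0 else \<phi> z / z)" for z
  have hol\<psi>: "\<psi> holomorphic_on ball 0 1"
    by (rule pole_theorem_open_0[OF hol, of 0]) (auto simp: \<psi>_def \<phi>0)
  have \<psi>nz: "\<psi> z \<noteq> 0" if "z \<in> ball 0 1" for z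
    using d[of 0] inj_onD[OF inj, of z 0] \<phi>0 that by (auto simp: \<psi>_def)
  have holH: "(\<lambda>z. \<psi> z powi (n + 1) / deriv \<phi> z) holomorphic_on ball 0 1"
    by (intro holomorphic_intros hol\<psi> holomorphic_deriv[OF hol]) (use d \<psi>nz in auto)
  have feq: "f z = z powi (n + 1) * (\<psi> z powi (n + 1) / deriv \<phi> z)" if "0 < cmod z" "cmod z < 1" for z
    using that by (simp add: assms(3) \<psi>_def power_int_divide_distrib)
  note laurent = laurent_expansion_powi_mult[OF holH feq]
  have c0: "c k = 0" if "k < n + 1" for k using laurent(2)[OF _ _ that] by (simp add: assms(6))
  have csum: "((\<lambda>k. c k * z powi k) has_sum f z) {n + 1..}" if "0 < cmod z" "cmod z < 1" for z
    using laurent(3)[OF _ _ that] by (simp add: assms(6))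
  obtain h w where hw: "h holomorphic_on ball 0 1" "w holomorphic_on - {0}"
    "\<And>z. cmod z = 1 \<Longrightarrow> Re (w z) = 0"
    "\<And>z. 0 < cmod z \<Longrightarrow> cmod z < 1 \<Longrightarrow> f z = z * (h z + w z)"
    "h 0 = of_real (Re (c 1))"
    and hsum: "\<And>z. cmod z < 1 \<Longrightarrow>
       ((\<lambda>k. (c k + cnj (c (2 - k))) * z powi k) has_sum (z * h z - of_real (Re (c 1)) * z)) {1<..}"
    by (rule laurent_split[of "n + 1" c f, OF c0 csum]) blast+
  interpret loop_variation n \<gamma> \<phi> h w "Re (c 1)"
  proof
    show "\<phi> z powi (n + 1) = deriv \<phi> z * (z * (h z + w z))" if "0 < cmod z" "cmod z < 1" for z
      using hw(4)[OF that] d[of z] that by (simp add: assms(3) field_simps)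
  qed (use assms(1) riem hw in auto)
  have cc: "laurent_coeff (\<lambda>z. z powi (-2) * f z) k = c (k + 2)" for k
    using laurent_coeff_powi_mult[OF laurent(1), of "-2" k] by (simp add: assms(6))
  \<comment> \<open>The factor z^(-2) turns the reflection k \<mapsto> -k of the star operation into
    k \<mapsto> 2 - k, whose fixed index is 1.\<close>
  have a: "a k = (if k > 0 then c k + cnj (c (2 - k)) else 0)" for k
    using cc[of "- k"] by (simp add: assms(4) laurent_pos_def laurent_star_def assms(6)[symmetric] add.commute)
  have R: "R = c 1"
  proof -
    \<comment> \<open>An equality of total functions: at 0 both sides are 0, by division by 0 and by
      the value of a negative power of 0.\<close>
    have "(\<lambda>s. \<phi> s powi (n + 1) / (deriv \<phi> s * s ^ 2)) = (\<lambda>z. z powi (-2) * f z)"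
      by (auto simp: assms(3) power_int_minus field_simps)
    then show ?thesis using cc[of "- 1"] by (simp add: assms(5) Res0_eq_laurent_coeff)
  qed
  have main: "(\<lambda>k. a k * z powi k) summable_on UNIV \<and>
        (\<lambda>k. (c k + cnj (c (2 - k))) * z powi k) summable_on {1<..} \<and>
        has_L_action n (\<lambda>\<gamma>'. phi_plus \<gamma>' z) \<gamma>
          (deriv \<phi> z * ((\<Sum>\<^sub>\<infinity>k\<in>UNIV. a k * z powi k) - 1 / 2 * z * (R + cnj R))) \<and>
        deriv \<phi> z * ((\<Sum>\<^sub>\<infinity>k\<in>UNIV. a k * z powi k) - 1 / 2 * z * (R + cnj R))
        = deriv \<phi> z * (1 / 2 * (c 1 + cnj (c 1)) * z
            + (\<Sum>\<^sub>\<infinity>k\<in>{1<..}. (c k + cnj (c (2 - k))) * z powi k))"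
    if z: "z \<in> ball 0 1" for z
  proof -
    have re: "c 1 + cnj (c 1) = 2 * of_real (Re (c 1))" by (simp add: complex_add_cnj)
    have S: "((\<lambda>k. (c k + cnj (c (2 - k))) * z powi k) has_sum (z * h z - of_real (Re (c 1)) * z)) {1<..}"
      using hsum z by simp
    \<comment> \<open>At the fixed index the term is paired with its own conjugate, giving 2 Re (c
      1) z. The residue correction removes half of it, and what remains is exactly z * h z.\<close>
    moreover have "((\<lambda>k. (c k + cnj (c (2 - k))) * z powi k) has_sum (2 * of_real (Re (c 1)) * z)) {1}"
      by (rule has_sum_finiteI) (auto simp: re)
    ultimately have "((\<lambda>k. (c k + cnj (c (2 - k))) * z powi k) has_sum
        (z * h z - of_real (Re (c 1)) * z + 2 * of_real (Re (c 1)) * z)) ({1<..} \<union> {1})"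
      by (rule has_sum_Un_disjoint) auto
    also have "?this \<longleftrightarrow> ((\<lambda>k. a k * z powi k) has_sum
        (z * h z - of_real (Re (c 1)) * z + 2 * of_real (Re (c 1)) * z)) UNIV"
      by (rule has_sum_cong_neutral) (auto simp: a)
    finally have A: "((\<lambda>k. a k * z powi k) has_sum (z * h z + of_real (Re (c 1)) * z)) UNIV"
      by (simp add: algebra_simps)
    have eq1: "(\<Sum>\<^sub>\<infinity>k\<in>UNIV. a k * z powi k) - 1 / 2 * z * (R + cnj R) = z * h z"
      unfolding infsumI[OF A] R re by simp
    have eq2: "1 / 2 * (c 1 + cnj (c 1)) * z + (\<Sum>\<^sub>\<infinity>k\<in>{1<..}. (c k + cnj (c (2 - k))) * z powi k) = z * h z"
      unfolding infsumI[OF S] re by simp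
    show ?thesis
      unfolding eq1 eq2 using A S has_L_action_phi_plus[OF assms(2)] z by (auto simp: has_sum_imp_summable)
  qed
  show ?thesis using c0 csum main by blast
qed

end
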